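(* Let $\omega>0$, $\lambda>0$, $c,d,F,\sigma\in\mathbb{R}$, and let $(\bar a,\bar\beta)$, $\bar a\ne0$, be a stationary solution of the system $$2\omega\,\frac{da}{dT_1}+\lambda a\omega=-F\sin\beta,\qquad 2a\omega\,\frac{d\beta}{dT_1}+2\sigma\omega a-\frac{3da^3}{4}=-F\cos\beta. \tag{S}$$ For small $\epsilon>0$ consider the solution $u$ of $$\ddot u+\omega^2u+\epsilon\lambda\dot u+cu^2+\frac{d}{\epsilon}u^3=\epsilon^2F\cos(\tilde\omega_\epsilon t),\qquad\tilde\omega_\epsilon=\omega+\epsilon\sigma,$$ with $$u(0)=\epsilon a_0+o(\epsilon),\qquad \dot u(0)=-\epsilon\omega a_0\sin(\beta_0)+o(\epsilon),$$ where $(a_0,\beta_0)$ is close to the stationary solution $(\bar a,\bar\beta)$: $$|a_0-\bar a|\le\epsilon C_1,\qquad|\beta_0-\bar\beta|\le\epsilon C_2,$$ with constants $C_1,C_2$. If $$\sigma\le\frac{3d\bar a^2}{4\omega}-\frac12\sqrt{\frac{9d^2\bar a^4}{16\omega^2}-\lambda^2},$$ then there exists $\gamma>0$ such that, for all $0\le t\le t_\epsilon=\frac{\gamma}{\epsilon}$, $$u(t)=\epsilon\,a(\epsilon t)\cos\bigl(\tilde\omega_\epsilon t+\beta(\epsilon t)\bigr)+\epsilon^2r(\epsilon,t),$$ where $(a,\beta)$ is the solution of (S) with $a(0)=a_0$, $\beta(0)=\beta_0$, and $r(\epsilon,\cdot)$ is uniformly bounded in $C^2(0,t_\epsilon)$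.
   Context: A dot denotes $d/dt$; $T_1=\epsilon t$ is the slow time; $\epsilon>0$ is a small parameter. A stationary solution of (S) is a constant solution $(\bar a,\bar\beta)$. "$r(\epsilon,\cdot)$ is uniformly bounded in $C^2(0,t_\epsilon)$" means that there is a constant independent of $\epsilon$ (for $\epsilon>0$ small) bounding $|r|$, $|\partial_t r|$, $|\partial_t^2 r|$ on $(0,t_\epsilon)$.
   Formalization: The initial data are corrected to u(0)=εa₀cos(β₀)+O(ε²) and u̇(0)=−εωa₀sin(β₀)+O(ε²); as printed (no cosine, errors o(ε)) the expansion already fails at t=0. The expression under the square root is assumed nonnegative. *)

theory Defs
  imports Complex_Main "HOL-Library.Landau_Symbols"
begin

text \<open>
  Throughout, \<open>lam\<close> is the damping coefficient \<open>\<lambda>\<close>. Derivatives are taken within the interval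
  \<open>I\<close> on which a solution lives, hence are one-sided at its endpoints.
\<close>

definition slow_solution ::
  "real \<Rightarrow> real \<Rightarrow> real \<Rightarrow> real \<Rightarrow> real \<Rightarrow> real set \<Rightarrow> (real \<Rightarrow> real) \<Rightarrow> (real \<Rightarrow> real) \<Rightarrow> bool"
  where "slow_solution \<omega> lam d F \<sigma> I a \<beta> \<longleftrightarrow>
    (\<exists>a' \<beta>'. \<forall>T\<in>I.
       (a has_real_derivative a' T) (at T within I) \<and>
       (\<beta> has_real_derivative \<beta>' T) (at T within I) \<and>
       2 * \<omega> * a' T + lam * a T * \<omega> = - F * sin (\<beta> T) \<and>
       2 * a T * \<omega> * \<beta>' T + 2 * \<sigma> * \<omega> * a T - 3 * d * a T ^ 3 / 4 = - F * cos (\<beta> T))"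

definition slow_stationary ::
  "real \<Rightarrow> real \<Rightarrow> real \<Rightarrow> real \<Rightarrow> real \<Rightarrow> real \<Rightarrow> real \<Rightarrow> bool"
  where "slow_stationary \<omega> lam d F \<sigma> abar \<beta>bar \<longleftrightarrow>
    slow_solution \<omega> lam d F \<sigma> UNIV (\<lambda>_. abar) (\<lambda>_. \<beta>bar)"

text \<open>
  \<open>u\<close> solves the initial value problem for the forced oscillator on \<open>I\<close> (an interval containing
  \<open>0\<close>) with \<open>u(0) = u\<^sub>0\<close> and \<open>u'(0) = v\<^sub>0\<close>.
\<close>

definition oscillator_solution ::
  "real \<Rightarrow> real \<Rightarrow> real \<Rightarrow> real \<Rightarrow> real \<Rightarrow> real \<Rightarrow> real \<Rightarrow> real set \<Rightarrow> real \<Rightarrow> real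
     \<Rightarrow> (real \<Rightarrow> real) \<Rightarrow> bool"
  where "oscillator_solution \<omega> lam c d F \<sigma> \<epsilon> I u\<^sub>0 v\<^sub>0 u \<longleftrightarrow>
    (\<exists>u' u''.
       (\<forall>t\<in>I.
          (u has_real_derivative u' t) (at t within I) \<and>
          (u' has_real_derivative u'' t) (at t within I) \<and>
          u'' t + \<omega>\<^sup>2 * u t + \<epsilon> * lam * u' t + c * (u t)\<^sup>2 + d / \<epsilon> * u t ^ 3
            = \<epsilon>\<^sup>2 * F * cos ((\<omega> + \<epsilon> * \<sigma>) * t)) \<and>
       u 0 = u\<^sub>0 \<and> u' 0 = v\<^sub>0)"

definition C2_bounded_on :: "real set \<Rightarrow> real \<Rightarrow> (real \<Rightarrow> real) \<Rightarrow> bool"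
  where "C2_bounded_on S K r \<longleftrightarrow>
    (\<exists>r' r''.
       continuous_on S r'' \<and>
       (\<forall>t\<in>S.
          (r has_real_derivative r' t) (at t within S) \<and>
          (r' has_real_derivative r'' t) (at t within S) \<and>
          \<bar>r t\<bar> \<le> K \<and> \<bar>r' t\<bar> \<le> K \<and> \<bar>r'' t\<bar> \<le> K))"

text \<open>
  Initial data \<open>(u\<^sub>0(\<epsilon>), v\<^sub>0(\<epsilon>))\<close> that agree to leading order with
  \<open>\<epsilon> a(\<epsilon> t) cos ((\<omega> + \<epsilon> \<sigma>) t + \<beta>(\<epsilon> t))\<close> and its time derivative at \<open>t = 0\<close>.
  The order \<open>O(\<epsilon>\<^sup>2)\<close> of the error and the factor \<open>cos \<beta>\<^sub>0\<close> are forced by an expansion with an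
  error \<open>\<epsilon>\<^sup>2 r\<close>, \<open>r\<close> bounded in \<open>C\<^sup>2\<close>. The often written short form
  \<open>u(0) = \<epsilon> a\<^sub>0 + o(\<epsilon>)\<close>, \<open>u'(0) = - \<epsilon> \<omega> a\<^sub>0 sin \<beta>\<^sub>0 + o(\<epsilon>)\<close> is not enough, as evaluation at
  \<open>t = 0\<close> shows: without the cosine it would need \<open>a\<^sub>0 (1 - cos \<beta>\<^sub>0) = O(\<epsilon>)\<close>, which fails near
  a stationary solution with nonzero amplitude because there \<open>sin \<beta>\<close> is not \<open>0\<close>.
\<close>

definition compatible_initial_data ::
  "real \<Rightarrow> (real \<Rightarrow> real) \<Rightarrow> (real \<Rightarrow> real) \<Rightarrow> (real \<Rightarrow> real) \<Rightarrow> (real \<Rightarrow> real) \<Rightarrow> bool"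
  where "compatible_initial_data \<omega> a\<^sub>0 \<beta>\<^sub>0 u\<^sub>0 v\<^sub>0 \<longleftrightarrow>
    (\<lambda>\<epsilon>. u\<^sub>0 \<epsilon> - \<epsilon> * a\<^sub>0 \<epsilon> * cos (\<beta>\<^sub>0 \<epsilon>)) \<in> O[at_right 0](\<lambda>\<epsilon>. \<epsilon>\<^sup>2) \<and>
    (\<lambda>\<epsilon>. v\<^sub>0 \<epsilon> + \<epsilon> * \<omega> * a\<^sub>0 \<epsilon> * sin (\<beta>\<^sub>0 \<epsilon>)) \<in> O[at_right 0](\<lambda>\<epsilon>. \<epsilon>\<^sup>2)"

end

theory Submission
  imports Defs "HOL-Analysis.Analysis"
begin

text \<open>
  Write \<open>u = \<epsilon> w\<close>, \<open>\<Omega> = \<omega> + \<epsilon> \<sigma>\<close> and pass to the complex envelope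
  \<open>z = (w - \<i> w' / \<Omega>) exp (- \<i> \<Omega> t)\<close>. The oscillator becomes \<open>z' = \<epsilon> f(\<epsilon>, t, z)\<close>, where \<open>f\<close> is a
  trigonometric polynomial in \<open>\<Omega> t\<close> with coefficients polynomial in \<open>z\<close> and its conjugate. The mean
  of \<open>f\<close> differs by \<open>O(\<epsilon>)\<close> from the field of the slow system, which in the variable
  \<open>Z = a exp (\<i> \<beta>)\<close> is polynomial too. The oscillating part of \<open>f\<close> has a primitive along the
  solution up to \<open>O(\<epsilon>)\<close>, so \<open>z\<close> and \<open>Z(\<epsilon> t)\<close> stay \<open>O(\<epsilon>)\<close> close for times of order \<open>1 / \<epsilon>\<close>.
  Since \<open>\<gamma>\<close> may be chosen small, a contraction argument gives existence, solutions stay in a fixed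
  ball, and no Gronwall inequality is needed.
\<close>

subsection \<open>Ordinary differential equations on short intervals\<close>

text \<open>After the scaling \<open>u = \<epsilon> w\<close> every term beyond the harmonic part
  carries the same factor \<epsilon>. The obstacle is the time scale: a field error of order 1,
  weighted by \<epsilon> and integrated up to \<open>\<gamma> / \<epsilon>\<close>, is still of
  order 1, so the oscillating part has to gain a factor \<epsilon> by cancellation and cannot simply
  be bounded. Complex variables are used because the phase equation divides by the amplitude,
  whereas the polynomial fields are Lipschitz on every ball. Only the zeroth harmonic survives
  averaging; the square of a sinusoid contributes nothing to it, which is why \<open>c\<close> is
  absent from the slow system, and the cube contributes the coefficient \<open>3 d / 8\<close>. All
  bounds are uniform in small \<epsilon>, so \<gamma> can be fixed before \<epsilon>. It enters
  through products \<open>M * \<gamma>\<close>: at most 1/2, they give the contraction and let the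
  largest deviation be absorbed; small against \<open>abar\<close>, they confine solutions to balls
  and keep the slow amplitude away from zero.\<close>

lemma vector_derivative_norm_bound:
  fixes f :: "real \<Rightarrow> 'a::real_normed_vector"
  assumes "\<And>s. s \<in> {a..b} \<Longrightarrow> (f has_vector_derivative f' s) (at s within {a..b})"
    and "\<And>s. s \<in> {a..b} \<Longrightarrow> norm (f' s) \<le> B"
    and "t \<in> {a..b}"
  shows "norm (f t - f a) \<le> B * (t - a)"
proof -
  have "norm (f t - f a) \<le> B * norm (t - a)"
  proof (rule differentiable_bound)
    show "convex {a..b}"
      by (rule convex_real_interval)
    show "(f has_derivative (\<lambda>h. h *\<^sub>R f' s)) (at s within {a..b})" if "s \<in> {a..b}" for s
      using assms(1)[OF that] by (simp add: has_vector_derivative_def)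
    show "onorm (\<lambda>h. h *\<^sub>R f' s) \<le> B" if "s \<in> {a..b}" for s
      by (rule onorm_le) (use mult_left_mono[OF assms(2)[OF that] abs_ge_zero] in \<open>simp add: mult.commute\<close>)
  qed (use assms(3) in auto)
  then show ?thesis
    using assms(3) by simp
qed

text \<open>First exit argument: up to the first time at distance \<rho> the speed is at most
  \<open>B\<close>, so the distance reached is at most \<open>B * \<tau> < \<rho>\<close>. It
  confines an arbitrary given solution, not just a constructed one, and so spares a uniqueness
  theorem.\<close>

lemma solution_stays_in_ball:
  fixes x :: "real \<Rightarrow> 'a::real_normed_vector"
  assumes der: "\<And>t. t \<in> {0..\<tau>} \<Longrightarrow> (x has_vector_derivative x' t) (at t within {0..\<tau>})"
    and bnd: "\<And>t. t \<in> {0..\<tau>} \<Longrightarrow> norm (x t - x 0) \<le> \<rho> \<Longrightarrow> norm (x' t) \<le> B"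
    and "0 < \<rho>" "0 \<le> B" "B * \<tau> < \<rho>" "t \<in> {0..\<tau>}"
  shows "norm (x t - x 0) \<le> \<rho>"
proof (rule ccontr)
  assume "\<not> ?thesis"
  then have ex: "norm (x t - x 0) > \<rho>" by simp
  have cont: "continuous_on {0..\<tau>} (\<lambda>s. norm (x s - x 0))"
    using has_vector_derivative_continuous[OF der]
    by (intro continuous_intros) (simp add: continuous_on_eq_continuous_within)
  define S where "S = {0..\<tau>} \<inter> (\<lambda>s. norm (x s - x 0)) -` {\<rho>..}"
  have S: "closed S"
    unfolding S_def by (intro continuous_closed_preimage cont) auto
  have "t \<in> S" and bdd: "bdd_below S"
    using ex assms(6) by (auto simp: S_def)
  define m where "m = Inf S"
  have "m \<in> S"
    unfolding m_def using S \<open>t \<in> S\<close> bdd by (intro closed_contains_Inf) auto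
  then have m: "0 \<le> m" "m \<le> \<tau>" "\<rho> \<le> norm (x m - x 0)"
    by (auto simp: S_def)
  have below: "norm (x s - x 0) < \<rho>" if "s \<in> {0..<m}" for s
  proof (rule ccontr)
    assume "\<not> ?thesis"
    then have "s \<in> S" using that m by (auto simp: S_def)
    then have "m \<le> s" unfolding m_def using bdd by (rule cInf_lower)
    with that show False by simp
  qed
  \<comment> \<open>The speed bound is available at \<open>m\<close> itself only if the distance
    there does not exceed \<rho>; continuity from the left supplies this.\<close>
  have at_m: "norm (x m - x 0) \<le> \<rho>"
  proof (cases "m = 0")
    case False
    have closure: "closure {0..<m} = {0..m}"
      using False m(1) by simp
    show ?thesis
    proof (rule continuous_le_on_closure[of "{0..<m}" "\<lambda>s. norm (x s - x 0)"])
      show "continuous_on (closure {0..<m}) (\<lambda>s. norm (x s - x 0))"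
        unfolding closure by (rule continuous_on_subset[OF cont]) (use m in auto)
      show "m \<in> closure {0..<m}"
        unfolding closure using m(1) by simp
      show "norm (x s - x 0) \<le> \<rho>" if "s \<in> {0..<m}" for s
        using below[OF that] by simp
    qed
  qed (use \<open>0 < \<rho>\<close> in simp)
  have "norm (x m - x 0) \<le> B * (m - 0)"
  proof (rule vector_derivative_norm_bound)
    show "(x has_vector_derivative x' s) (at s within {0..m})" if "s \<in> {0..m}" for s
      using der[of s] that m by (auto intro: has_vector_derivative_within_subset)
    show "norm (x' s) \<le> B" if "s \<in> {0..m}" for s
      using that m at_m below[of s] bnd[of s] by (cases "s = m") auto
  qed (use m in auto)
  also have "\<dots> \<le> B * \<tau>"
    using m \<open>0 \<le> B\<close> by (simp add: mult_left_mono)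
  finally show False
    using m \<open>B * \<tau> < \<rho>\<close> by simp
qed

text \<open>Banach's fixed point theorem for the integral operator in the sup norm:
  \<open>B * \<tau> \<le> \<rho>\<close> keeps the ball invariant, and \<open>L * \<tau> < 1\<close>
  makes a single application contract.\<close>

lemma picard_local_existence:
  fixes f :: "real \<Rightarrow> 'a::banach \<Rightarrow> 'a"
  assumes cont: "continuous_on ({0..\<tau>} \<times> cball x\<^sub>0 \<rho>) (\<lambda>(t, x). f t x)"
    and bnd: "\<And>t x. t \<in> {0..\<tau>} \<Longrightarrow> x \<in> cball x\<^sub>0 \<rho> \<Longrightarrow> norm (f t x) \<le> B"
    and lip: "\<And>t x y. t \<in> {0..\<tau>} \<Longrightarrow> x \<in> cball x\<^sub>0 \<rho> \<Longrightarrow> y \<in> cball x\<^sub>0 \<rho> \<Longrightarrow>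
      norm (f t x - f t y) \<le> L * norm (x - y)"
    and "0 \<le> \<tau>" "0 \<le> \<rho>" "0 \<le> B" "B * \<tau> \<le> \<rho>" "0 \<le> L" "L * \<tau> < 1"
  obtains x where "x 0 = x\<^sub>0"
    and "\<And>t. t \<in> {0..\<tau>} \<Longrightarrow> x t \<in> cball x\<^sub>0 \<rho>"
    and "\<And>t. t \<in> {0..\<tau>} \<Longrightarrow> (x has_vector_derivative f t (x t)) (at t within {0..\<tau>})"
proof -
  \<comment> \<open>The complete space at hand consists of bounded continuous functions on the whole
    line, so functions on \<open>{0..\<tau>}\<close> are extended by freezing time at the
    endpoints.\<close>
  define clip where "clip t = max 0 (min t \<tau>)" for t
  have clip: "clip t \<in> {0..\<tau>}" for t
    using \<open>0 \<le> \<tau>\<close> by (auto simp: clip_def)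
  have clip_id: "clip t = t" if "t \<in> {0..\<tau>}" for t
    using that by (auto simp: clip_def)
  have clip_cont: "continuous_on UNIV clip"
    unfolding clip_def by (intro continuous_intros)
  define S where "S = PiC UNIV (\<lambda>_::real. cball x\<^sub>0 \<rho>)"
  have in_S: "x t \<in> cball x\<^sub>0 \<rho>" if "x \<in> S" for x t
    using that by (auto simp: S_def mem_PiC_iff simp del: mem_cball)
  have f_cont: "continuous_on {0..\<tau>} (\<lambda>s. f s (apply_bcontfun x s))" if "x \<in> S" for x
  proof -
    have "continuous_on {0..\<tau>} (\<lambda>s. case (s, apply_bcontfun x s) of (t, y) \<Rightarrow> f t y)"
      by (rule continuous_on_compose2[OF cont]) (use in_S[OF that] in \<open>auto intro!: continuous_intros\<close>)
    then show ?thesis by simp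
  qed
  have f_cont': "continuous_on {0..clip t} (\<lambda>s. f s (apply_bcontfun x s))" if "x \<in> S" for x t
    by (rule continuous_on_subset[OF f_cont[OF that]]) (use clip[of t] in auto)
  define P where "P x t = x\<^sub>0 + integral {0..clip t} (\<lambda>s. f s (apply_bcontfun x s))"
    for x :: "real \<Rightarrow>\<^sub>C 'a" and t
  have P_ball: "dist (P x t) x\<^sub>0 \<le> \<rho>" if "x \<in> S" for x t
  proof -
    have "norm (integral {0..clip t} (\<lambda>s. f s (apply_bcontfun x s))) \<le> B * (clip t - 0)"
      using clip[of t] bnd in_S[OF that] by (intro integral_bound f_cont' that) auto
    also have "\<dots> \<le> B * \<tau>"
      using clip[of t] \<open>0 \<le> B\<close> by (simp add: mult_left_mono)
    finally show ?thesis
      using \<open>B * \<tau> \<le> \<rho>\<close> by (simp add: P_def dist_norm)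
  qed
  have P_cont: "continuous_on UNIV (P x)" if "x \<in> S" for x
  proof -
    let ?J = "\<lambda>u. integral {0..u} (\<lambda>s. f s (apply_bcontfun x s))"
    have "continuous_on {0..\<tau>} ?J"
      unfolding continuous_on_eq_continuous_within
      by (intro ballI has_vector_derivative_continuous[OF integral_has_vector_derivative]
          f_cont[OF that])
    then have "continuous_on UNIV (\<lambda>t. ?J (clip t))"
      by (rule continuous_on_compose2[OF _ clip_cont]) (use clip in blast)
    then have "continuous_on UNIV (\<lambda>t. x\<^sub>0 + ?J (clip t))"
      by (rule continuous_on_add[OF continuous_on_const])
    then show ?thesis
      by (simp only: P_def[abs_def])
  qed
  have P_bcont: "P x \<in> bcontfun" if "x \<in> S" for x
    using P_cont[OF that] P_ball[OF that] by (auto simp: bcontfun_def bounded_def dist_commute)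
  have apply_P: "apply_bcontfun (Bcontfun (P x)) = P x" if "x \<in> S" for x
    using P_bcont[OF that] by (simp add: Bcontfun_inverse)
  have "\<exists>!x\<in>S. Bcontfun (P x) = x"
  proof (rule Banach_fix[where c = "L * \<tau>"])
    show "complete S"
      unfolding S_def by (intro closed_PiC complete_eq_closed[THEN iffD2]) auto
    have "const_bcontfun x\<^sub>0 \<in> S"
      using \<open>0 \<le> \<rho>\<close> by (simp add: S_def mem_PiC_iff const_bcontfun.rep_eq)
    then show "S \<noteq> {}" by blast
    show "(\<lambda>x. Bcontfun (P x)) ` S \<subseteq> S"
      using apply_P P_ball by (auto simp: S_def mem_PiC_iff dist_commute)
    show "dist (Bcontfun (P x)) (Bcontfun (P y)) \<le> L * \<tau> * dist x y" if "x \<in> S" "y \<in> S" for x y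
    proof (rule dist_bound)
      fix t
      have "P x t - P y t = integral {0..clip t} (\<lambda>s. f s (apply_bcontfun x s) - f s (apply_bcontfun y s))"
        unfolding P_def
        by (subst integral_diff) (auto intro!: integrable_continuous_real f_cont' that)
      also have "norm \<dots> \<le> (L * dist x y) * (clip t - 0)"
      proof (rule integral_bound)
        fix s assume s: "s \<in> {0..clip t}"
        have "norm (f s (apply_bcontfun x s) - f s (apply_bcontfun y s))
            \<le> L * norm (apply_bcontfun x s - apply_bcontfun y s)"
          using s clip[of t] in_S[OF that(1)] in_S[OF that(2)] by (intro lip) auto
        also have "\<dots> \<le> L * dist x y"
          using dist_bounded[of x s y] \<open>0 \<le> L\<close> by (simp add: dist_norm mult_left_mono)
        finally show "norm (f s (apply_bcontfun x s) - f s (apply_bcontfun y s)) \<le> L * dist x y" .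
      qed (use clip[of t] that in \<open>auto intro!: continuous_intros f_cont'\<close>)
      also have "\<dots> \<le> L * \<tau> * dist x y"
        using clip[of t] \<open>0 \<le> L\<close> mult_left_mono[of "clip t" \<tau> "L * dist x y"] by (simp add: mult_ac)
      finally show "dist (apply_bcontfun (Bcontfun (P x)) t) (apply_bcontfun (Bcontfun (P y)) t)
          \<le> L * \<tau> * dist x y"
        using that by (simp add: apply_P dist_norm)
    qed
  qed (use assms(4,8,9) in simp_all)
  then obtain x where x: "x \<in> S" "Bcontfun (P x) = x" by blast
  have fix_eq: "apply_bcontfun x t = P x t" for t
    using apply_P[OF x(1)] x(2) by simp
  show thesis
  proof
    show "apply_bcontfun x 0 = x\<^sub>0"
      using \<open>0 \<le> \<tau>\<close> by (subst fix_eq) (simp add: P_def clip_def)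
    show "apply_bcontfun x t \<in> cball x\<^sub>0 \<rho>" for t
      by (rule in_S[OF x(1)])
    show "(apply_bcontfun x has_vector_derivative f t (apply_bcontfun x t)) (at t within {0..\<tau>})"
      if t: "t \<in> {0..\<tau>}" for t
    \<comment> \<open>On \<open>{0..\<tau>}\<close> clipping is the identity, so the fixed point
      equation becomes the integral equation, which the fundamental theorem of calculus
      differentiates.\<close>
    proof (rule has_vector_derivative_transform[OF t])
      show "((\<lambda>u. x\<^sub>0 + integral {0..u} (\<lambda>s. f s (apply_bcontfun x s)))
          has_vector_derivative f t (apply_bcontfun x t)) (at t within {0..\<tau>})"
        using has_vector_derivative_add[OF has_vector_derivative_const
            integral_has_vector_derivative[OF f_cont[OF x(1)] t]] by simp
      show "apply_bcontfun x u = x\<^sub>0 + integral {0..u} (\<lambda>s. f s (apply_bcontfun x s))"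
        if "u \<in> {0..\<tau>}" for u
        by (subst fix_eq) (simp add: P_def clip_id[OF that])
    qed
  qed
qed

subsection \<open>Functions with an almost bounded primitive\<close>

text \<open>One constant bounds both the size and the derivative divided by \<epsilon>, which keeps
  products and conjugates simple. An envelope qualifies because its derivative is \<epsilon> times a
  bounded field.\<close>

definition slowly_varying :: "real \<Rightarrow> real set \<Rightarrow> real \<Rightarrow> (real \<Rightarrow> complex) \<Rightarrow> bool"
  where "slowly_varying \<epsilon> S B x \<longleftrightarrow>
    (\<exists>x'. \<forall>t\<in>S. (x has_vector_derivative x' t) (at t within S) \<and>
       norm (x t) \<le> B \<and> norm (x' t) \<le> \<epsilon> * B)"

text \<open>
  The integral of such an \<open>h\<close> over a time of order \<open>1 / \<epsilon>\<close> is still of order \<open>1\<close>.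
\<close>

definition averages_out :: "real \<Rightarrow> real set \<Rightarrow> real \<Rightarrow> (real \<Rightarrow> complex) \<Rightarrow> bool"
  where "averages_out \<epsilon> S B h \<longleftrightarrow>
    (\<exists>V V'. \<forall>t\<in>S. (V has_vector_derivative V' t) (at t within S) \<and>
       norm (V t) \<le> B \<and> norm (V' t - h t) \<le> \<epsilon> * B)"

lemma slowly_varyingE:
  assumes "slowly_varying \<epsilon> S B x"
  obtains x' where "\<And>t. t \<in> S \<Longrightarrow> (x has_vector_derivative x' t) (at t within S)"
    and "\<And>t. t \<in> S \<Longrightarrow> norm (x t) \<le> B" "\<And>t. t \<in> S \<Longrightarrow> norm (x' t) \<le> \<epsilon> * B"
proof -
  obtain x' where "\<forall>t\<in>S. (x has_vector_derivative x' t) (at t within S) \<and>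
       norm (x t) \<le> B \<and> norm (x' t) \<le> \<epsilon> * B"
    using assms unfolding slowly_varying_def by (elim exE)
  then show thesis
    by (intro that[of x']) blast+
qed

lemma averages_outE:
  assumes "averages_out \<epsilon> S B h"
  obtains V V' where "\<And>t. t \<in> S \<Longrightarrow> (V has_vector_derivative V' t) (at t within S)"
    and "\<And>t. t \<in> S \<Longrightarrow> norm (V t) \<le> B" "\<And>t. t \<in> S \<Longrightarrow> norm (V' t - h t) \<le> \<epsilon> * B"
proof -
  obtain V V' where "\<forall>t\<in>S. (V has_vector_derivative V' t) (at t within S) \<and>
       norm (V t) \<le> B \<and> norm (V' t - h t) \<le> \<epsilon> * B"
    using assms unfolding averages_out_def by (elim exE)
  then show thesis
    by (intro that[of V V']) blast+
qed

lemma slowly_varying_const: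
  assumes "0 \<le> \<epsilon>" "norm k \<le> B"
  shows "slowly_varying \<epsilon> S B (\<lambda>_. k)"
proof -
  have "0 \<le> \<epsilon> * B"
    using assms order_trans[OF norm_ge_zero assms(2)] by simp
  with assms show ?thesis
    unfolding slowly_varying_def by (intro exI[of _ "\<lambda>_. 0"]) auto
qed

lemma slowly_varying_cnj:
  assumes "slowly_varying \<epsilon> S B x"
  shows "slowly_varying \<epsilon> S B (\<lambda>t. cnj (x t))"
  using assms
proof (rule slowly_varyingE)
  fix x' assume "\<And>t. t \<in> S \<Longrightarrow> (x has_vector_derivative x' t) (at t within S)"
    "\<And>t. t \<in> S \<Longrightarrow> norm (x t) \<le> B" "\<And>t. t \<in> S \<Longrightarrow> norm (x' t) \<le> \<epsilon> * B"
  then show ?thesis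
    unfolding slowly_varying_def
    by (intro exI[of _ "\<lambda>t. cnj (x' t)"]) (auto intro: has_vector_derivative_cnj)
qed

text \<open>The factor 2 pays for the two terms of the product rule; the size alone would need only
  \<open>B * C\<close>.\<close>

lemma slowly_varying_mult:
  assumes "0 \<le> \<epsilon>" "slowly_varying \<epsilon> S B x" "slowly_varying \<epsilon> S C y"
  shows "slowly_varying \<epsilon> S (2 * B * C) (\<lambda>t. x t * y t)"
proof -
  obtain x' where x: "\<And>t. t \<in> S \<Longrightarrow> (x has_vector_derivative x' t) (at t within S)"
    "\<And>t. t \<in> S \<Longrightarrow> norm (x t) \<le> B" "\<And>t. t \<in> S \<Longrightarrow> norm (x' t) \<le> \<epsilon> * B"
    using assms(2) by (rule slowly_varyingE) (rule that; blast)
  obtain y' where y: "\<And>t. t \<in> S \<Longrightarrow> (y has_vector_derivative y' t) (at t within S)"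
    "\<And>t. t \<in> S \<Longrightarrow> norm (y t) \<le> C" "\<And>t. t \<in> S \<Longrightarrow> norm (y' t) \<le> \<epsilon> * C"
    using assms(3) by (rule slowly_varyingE) (rule that; blast)
  have "((\<lambda>t. x t * y t) has_vector_derivative (x t * y' t + x' t * y t)) (at t within S) \<and>
      norm (x t * y t) \<le> 2 * B * C \<and> norm (x t * y' t + x' t * y t) \<le> \<epsilon> * (2 * B * C)"
    if t: "t \<in> S" for t
  proof -
    have nn: "0 \<le> B" "0 \<le> C"
      using order_trans[OF norm_ge_zero x(2)[OF t]] order_trans[OF norm_ge_zero y(2)[OF t]] .
    have "norm (x t * y t) \<le> B * C"
      unfolding norm_mult using x[OF t] y[OF t] nn by (intro mult_mono) auto
    moreover have "B * C \<le> 2 * B * C"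
      using nn by simp
    moreover have "norm (x t * y' t) \<le> B * (\<epsilon> * C)" "norm (x' t * y t) \<le> (\<epsilon> * B) * C"
      unfolding norm_mult using x[OF t] y[OF t] nn assms(1) by (auto intro!: mult_mono)
    then have "norm (x t * y' t + x' t * y t) \<le> \<epsilon> * (2 * B * C)"
      by (intro order_trans[OF norm_triangle_ineq]) (simp add: algebra_simps)
    ultimately show ?thesis
      using has_vector_derivative_mult[OF x(1)[OF t] y(1)[OF t]] by simp
  qed
  then show ?thesis
    unfolding slowly_varying_def by (intro exI[of _ "\<lambda>t. x t * y' t + x' t * y t"] ballI)
qed

lemma averages_out_mono:
  assumes "0 \<le> \<epsilon>" "averages_out \<epsilon> S B h" "B \<le> C"
  shows "averages_out \<epsilon> S C h"
proof -
  obtain V V' where V: "\<And>t. t \<in> S \<Longrightarrow> (V has_vector_derivative V' t) (at t within S)"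
    "\<And>t. t \<in> S \<Longrightarrow> norm (V t) \<le> B" "\<And>t. t \<in> S \<Longrightarrow> norm (V' t - h t) \<le> \<epsilon> * B"
    using assms(2) by (rule averages_outE) (rule that; blast)
  have "\<epsilon> * B \<le> \<epsilon> * C"
    using assms by (simp add: mult_left_mono)
  then show ?thesis
    unfolding averages_out_def
    by (intro exI[of _ V] exI[of _ V'] ballI conjI V(1) order_trans[OF V(2) assms(3)]
        order_trans[OF V(3)])
qed

lemma averages_out_add:
  assumes "averages_out \<epsilon> S B h" "averages_out \<epsilon> S C k"
  shows "averages_out \<epsilon> S (B + C) (\<lambda>t. h t + k t)"
proof -
  obtain U U' where U: "\<And>t. t \<in> S \<Longrightarrow> (U has_vector_derivative U' t) (at t within S)"
    "\<And>t. t \<in> S \<Longrightarrow> norm (U t) \<le> B" "\<And>t. t \<in> S \<Longrightarrow> norm (U' t - h t) \<le> \<epsilon> * B"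
    using assms(1) by (rule averages_outE) (rule that; blast)
  obtain V V' where V: "\<And>t. t \<in> S \<Longrightarrow> (V has_vector_derivative V' t) (at t within S)"
    "\<And>t. t \<in> S \<Longrightarrow> norm (V t) \<le> C" "\<And>t. t \<in> S \<Longrightarrow> norm (V' t - k t) \<le> \<epsilon> * C"
    using assms(2) by (rule averages_outE) (rule that; blast)
  have "((\<lambda>t. U t + V t) has_vector_derivative (U' t + V' t)) (at t within S) \<and>
      norm (U t + V t) \<le> B + C \<and> norm (U' t + V' t - (h t + k t)) \<le> \<epsilon> * (B + C)"
    if t: "t \<in> S" for t
  proof -
    have "norm (U' t + V' t - (h t + k t)) \<le> \<epsilon> * B + \<epsilon> * C"
      unfolding add_diff_add
      by (rule order_trans[OF norm_triangle_ineq add_mono[OF U(3)[OF t] V(3)[OF t]]])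
    then show ?thesis
      using order_trans[OF norm_triangle_ineq add_mono[OF U(2)[OF t] V(2)[OF t]]]
        has_vector_derivative_add[OF U(1)[OF t] V(1)[OF t]]
      by (simp add: distrib_left)
  qed
  then show ?thesis
    unfolding averages_out_def
    by (intro exI[of _ "\<lambda>t. U t + V t"] exI[of _ "\<lambda>t. U' t + V' t"] ballI)
qed

lemma averages_out_cmult:
  assumes "averages_out \<epsilon> S B h"
  shows "averages_out \<epsilon> S (norm k * B) (\<lambda>t. k * h t)"
proof -
  obtain V V' where V: "\<And>t. t \<in> S \<Longrightarrow> (V has_vector_derivative V' t) (at t within S)"
    "\<And>t. t \<in> S \<Longrightarrow> norm (V t) \<le> B" "\<And>t. t \<in> S \<Longrightarrow> norm (V' t - h t) \<le> \<epsilon> * B"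
    using assms by (rule averages_outE) (rule that; blast)
  have "((\<lambda>t. k * V t) has_vector_derivative (k * V' t)) (at t within S) \<and>
      norm (k * V t) \<le> norm k * B \<and> norm (k * V' t - k * h t) \<le> \<epsilon> * (norm k * B)"
    if t: "t \<in> S" for t
    using mult_left_mono[OF V(2)[OF t] norm_ge_zero[of k]] mult_left_mono[OF V(3)[OF t] norm_ge_zero[of k]]
      has_vector_derivative_mult_right[OF V(1)[OF t], of k]
    by (simp add: norm_mult right_diff_distrib[symmetric] mult.left_commute)
  then show ?thesis
    unfolding averages_out_def
    by (intro exI[of _ "\<lambda>t. k * V t"] exI[of _ "\<lambda>t. k * V' t"] ballI)
qed

text \<open>One integration by parts: \<open>x cis (\<nu> t) / (\<i> \<nu>)\<close> is the near primitive.\<close>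

lemma averages_out_cis:
  assumes "slowly_varying \<epsilon> S B x" "\<nu> \<noteq> 0"
  shows "averages_out \<epsilon> S (B / \<bar>\<nu>\<bar>) (\<lambda>t. x t * cis (\<nu> * t))"
proof -
  obtain x' where x: "\<And>t. t \<in> S \<Longrightarrow> (x has_vector_derivative x' t) (at t within S)"
    "\<And>t. t \<in> S \<Longrightarrow> norm (x t) \<le> B" "\<And>t. t \<in> S \<Longrightarrow> norm (x' t) \<le> \<epsilon> * B"
    using assms(1) by (rule slowly_varyingE) (rule that; blast)
  define k where "k = 1 / (\<i> * of_real \<nu>)"
  have norm_k: "norm k = 1 / \<bar>\<nu>\<bar>"
    by (simp add: k_def norm_divide norm_mult)
  have cis_der: "((\<lambda>t. cis (\<nu> * t)) has_vector_derivative (\<i> * of_real \<nu> * cis (\<nu> * t))) (at t within S)" for t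
    unfolding has_vector_derivative_def
    by (auto intro!: derivative_eq_intros simp: scaleR_conv_of_real)
  define V where "V t = k * (x t * cis (\<nu> * t))" for t
  define V' where "V' t = k * (x t * (\<i> * of_real \<nu> * cis (\<nu> * t)) + x' t * cis (\<nu> * t))" for t
  have "(V has_vector_derivative V' t) (at t within S)" if "t \<in> S" for t
    unfolding V_def[abs_def] V'_def
    by (intro has_vector_derivative_mult_right has_vector_derivative_mult x(1) cis_der that)
  moreover have "norm (V t) \<le> B / \<bar>\<nu>\<bar>" if "t \<in> S" for t
    using divide_right_mono[OF x(2)[OF that], of "\<bar>\<nu>\<bar>"] by (simp add: V_def norm_mult norm_k)
  moreover have "norm (V' t - x t * cis (\<nu> * t)) \<le> \<epsilon> * (B / \<bar>\<nu>\<bar>)" if "t \<in> S" for t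
  proof -
    have "V' t - x t * cis (\<nu> * t) = k * (x' t * cis (\<nu> * t))"
      using assms(2) by (simp add: k_def V'_def field_simps)
    then show ?thesis
      using divide_right_mono[OF x(3)[OF that], of "\<bar>\<nu>\<bar>"] by (simp add: norm_mult norm_k)
  qed
  ultimately show ?thesis
    unfolding averages_out_def by (intro exI[of _ V] exI[of _ V']) simp
qed

subsection \<open>The envelope equation and its mean\<close>

text \<open>Bookkeeping of harmonics: \<open>E\<close> stands for
  \<open>exp (\<i> \<Omega> t)\<close>, \<open>E'\<close> for its inverse and \<open>z'\<close> for
  the conjugate of \<open>z\<close>. Treating them as independent makes this a polynomial identity
  modulo \<open>E * E' = 1\<close>. The first bracket is free of \<open>E\<close> and becomes the
  mean; the square yields only the powers \<open>E\<close>, \<open>E'\<close>,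
  \<open>E' ^ 3\<close>, so \<open>c\<close> does not occur there.\<close>

lemma forcing_expansion:
  fixes z z' E E' D l F c d :: complex
  assumes EE': "E * E' = 1"
  shows "(D * ((z * E + z' * E') / 2) + F * ((E + E') / 2) + l * ((z * E - z' * E') / (2 * \<i>))
    - c * ((z * E + z' * E') / 2) ^ 2 - d * ((z * E + z' * E') / 2) ^ 3) * E' =
      (D / 2 * z + F / 2 - \<i> * l / 2 * z - 3 * d / 8 * (z * z * z')) +
      (- c / 4 * (z * z * E)
     + (- d / 8 * (z * z * z * E ^ 2)
     + (- c / 2 * (z * z' * E')
     + ((D / 2 + \<i> * l / 2) * (z' * E' ^ 2)
     + (F / 2 * (1 * E' ^ 2)
     + (- 3 * d / 8 * (z * z' * z' * E' ^ 2)
     + (- c / 4 * (z' * z' * E' ^ 3)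
     + (- d / 8 * (z' * z' * z' * E' ^ 4)))))))))"
    (is "(D * (?x / 2) + F * (?f / 2) + l * (?y / (2 * \<i>)) - c * (?x / 2) ^ 2 - d * (?x / 2) ^ 3) * E' = ?r")
proof -
  have *: "E * (E' * x) = x" for x
    using EE' by (simp add: mult.assoc[symmetric])
  have sq: "?x ^ 2 * E' = z * z * E + 2 * (z * z' * E') + z' * z' * E' ^ 3"
    by (simp add: power2_eq_square power3_eq_cube ring_distribs EE' * mult_ac)
  have cube: "?x ^ 3 * E' = z * z * z * E ^ 2 + 3 * (z * z * z') + 3 * (z * z' * z' * E' ^ 2)
      + z' * z' * z' * E' ^ 4"
    by (simp add: power2_eq_square power3_eq_cube ring_distribs EE' * mult_ac power4_eq_xxxx)
  have lin: "?x * E' = z + z' * E' ^ 2" "?y * E' = z - z' * E' ^ 2" "?f * E' = 1 + E' ^ 2"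
    by (simp_all add: power2_eq_square ring_distribs EE' * mult_ac)
  have "(D * (x / 2) + F * (f / 2) + l * (y / (2 * \<i>)) - c * (x / 2) ^ 2 - d * (x / 2) ^ 3) * E'
      = D / 2 * (x * E') + F / 2 * (f * E') - \<i> * l / 2 * (y * E')
        - c / 4 * (x ^ 2 * E') - d / 8 * (x ^ 3 * E')" for x y f
    by (simp add: power_divide field_simps)
  then have "(D * (?x / 2) + F * (?f / 2) + l * (?y / (2 * \<i>)) - c * (?x / 2) ^ 2 - d * (?x / 2) ^ 3) * E'
      = D / 2 * (?x * E') + F / 2 * (?f * E') - \<i> * l / 2 * (?y * E')
        - c / 4 * (?x ^ 2 * E') - d / 8 * (?x ^ 3 * E')" .
  also have "\<dots> = ?r"
    unfolding sq cube lin by (simp add: field_simps)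
  finally show ?thesis .
qed

lemma abs_sum5_le:
  fixes p q r s u :: real
  assumes "\<bar>p\<bar> \<le> P" "\<bar>q\<bar> \<le> Q" "\<bar>r\<bar> \<le> R" "\<bar>s\<bar> \<le> S" "\<bar>u\<bar> \<le> U"
  shows "\<bar>p + q + r - s - u\<bar> \<le> P + Q + R + S + U"
  using assms by linarith

locale weakly_nonlinear_oscillator =
  fixes \<omega> lam c d F \<sigma> :: real
  assumes \<omega>_pos: "\<omega> > 0"
begin

definition freq :: "real \<Rightarrow> real" where "freq \<epsilon> = \<omega> + \<epsilon> * \<sigma>"

text \<open>Chosen so that \<open>\<Omega>\<^sup>2 - \<omega>\<^sup>2 = \<epsilon> detuning\<close>.\<close>

definition detuning :: "real \<Rightarrow> real" where "detuning \<epsilon> = 2 * \<omega> * \<sigma> + \<epsilon> * \<sigma>\<^sup>2"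

text \<open>
  With \<open>w = Re \<zeta>\<close> and \<open>w' = - \<Omega> Im \<zeta>\<close>, the rescaled oscillator reads \<open>w'' + \<Omega>\<^sup>2 w = \<epsilon> force\<close>.
\<close>

definition force :: "real \<Rightarrow> real \<Rightarrow> complex \<Rightarrow> real"
  where "force \<epsilon> t \<zeta> = detuning \<epsilon> * Re \<zeta> + F * cos (freq \<epsilon> * t) + lam * freq \<epsilon> * Im \<zeta>
    - c * (Re \<zeta>)\<^sup>2 - d * Re \<zeta> ^ 3"

text \<open>Variation of constants: the envelope is constant for the free oscillator of frequency
  \<Omega>, and an acceleration \<open>\<epsilon> force\<close> enters its derivative multiplied by
  \<open>- \<i> / \<Omega>\<close> and rotated back by
  \<open>exp (- \<i> \<Omega> t)\<close>.\<close>

definition fast_field :: "real \<Rightarrow> real \<Rightarrow> complex \<Rightarrow> complex"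
  where "fast_field \<epsilon> t z =
    - (\<i> / of_real (freq \<epsilon>)) * (of_real (force \<epsilon> t (z * cis (freq \<epsilon> * t))) * cis (- (freq \<epsilon> * t)))"

text \<open>The zeroth harmonic of \<open>fast_field\<close>, as found in
  \<open>forcing_expansion\<close>. It still contains the frequency and detuning at \<epsilon>,
  which separates it from \<open>slow_field\<close>.\<close>

definition mean_field :: "real \<Rightarrow> complex \<Rightarrow> complex"
  where "mean_field \<epsilon> z = - (\<i> / of_real (freq \<epsilon>)) *
    (of_real (detuning \<epsilon>) / 2 * z + of_real F / 2 - \<i> * (of_real lam * of_real (freq \<epsilon>)) / 2 * z
      - 3 * of_real d / 8 * (z * z * cnj z))"

text \<open>Harmonics 1, 2, -1, -2, -3, -4, none of them zero. Factors such as \<open>1 *\<close>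
  and the right-nested sum give each summand the form required by
  \<open>averages_out_cis_freq\<close> and let the bounds be added one by one.\<close>

definition oscillating_field :: "real \<Rightarrow> real \<Rightarrow> complex \<Rightarrow> complex"
  where "oscillating_field \<epsilon> t z = - (\<i> / of_real (freq \<epsilon>)) *
    (- of_real c / 4 * (z * z * cis (1 * freq \<epsilon> * t))
     + (- of_real d / 8 * (z * z * z * cis (2 * freq \<epsilon> * t))
     + (- of_real c / 2 * (z * cnj z * cis ((- 1) * freq \<epsilon> * t))
     + ((of_real (detuning \<epsilon>) / 2 + \<i> * (of_real lam * of_real (freq \<epsilon>)) / 2) * (cnj z * cis ((- 2) * freq \<epsilon> * t))
     + (of_real F / 2 * (1 * cis ((- 2) * freq \<epsilon> * t))
     + (- 3 * of_real d / 8 * (z * cnj z * cnj z * cis ((- 2) * freq \<epsilon> * t))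
     + (- of_real c / 4 * (cnj z * cnj z * cis ((- 3) * freq \<epsilon> * t))
     + (- of_real d / 8 * (cnj z * cnj z * cnj z * cis ((- 4) * freq \<epsilon> * t))))))))))"

definition slow_field :: "complex \<Rightarrow> complex"
  where "slow_field z = - (\<i> / (2 * of_real \<omega>)) *
    (of_real F - \<i> * of_real lam * of_real \<omega> * z + 2 * of_real \<sigma> * of_real \<omega> * z
      - 3 * of_real d / 4 * (z * z * cnj z))"

text \<open>The last bound keeps \<open>freq \<epsilon>\<close> between \<open>\<omega> / 2\<close>
  and \<open>2 * \<omega>\<close>, so dividing by it costs a fixed constant;
  \<open>\<epsilon> \<le> 1\<close> absorbs higher powers of \<epsilon>.\<close>

definition small :: "real \<Rightarrow> bool"
  where "small \<epsilon> \<longleftrightarrow> 0 < \<epsilon> \<and> \<epsilon> \<le> 1 \<and> \<epsilon> * \<bar>\<sigma>\<bar> \<le> \<omega> / 2"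

lemma eventually_small: "\<forall>\<^sub>F \<epsilon> in at_right 0. small \<epsilon>"
proof -
  have "\<forall>\<^sub>F \<epsilon>::real in at_right 0. \<epsilon> * \<bar>\<sigma>\<bar> < \<omega> / 2"
    using \<omega>_pos by (intro order_tendstoD(2)[where y = 0]) (auto intro!: tendsto_eq_intros)
  moreover have "\<forall>\<^sub>F \<epsilon>::real in at_right 0. \<epsilon> < 1"
    by (rule eventually_at_rightI[of 0 1]) auto
  ultimately show ?thesis
    using eventually_at_right_less[of 0] by eventually_elim (auto simp: small_def)
qed

lemma freq_bounds:
  assumes "small \<epsilon>"
  shows "\<omega> / 2 \<le> freq \<epsilon>" "freq \<epsilon> \<le> 2 * \<omega>"
proof -
  have "\<bar>\<epsilon> * \<sigma>\<bar> \<le> \<omega> / 2"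
    using assms by (simp add: small_def abs_mult)
  then show "\<omega> / 2 \<le> freq \<epsilon>" "freq \<epsilon> \<le> 2 * \<omega>"
    using \<omega>_pos by (auto simp: freq_def)
qed

lemma freq_pos: "small \<epsilon> \<Longrightarrow> 0 < freq \<epsilon>"
  using freq_bounds(1) \<omega>_pos by (smt (verit) half_gt_zero)

lemma inverse_freq_bound:
  assumes "small \<epsilon>" "0 \<le> x"
  shows "x / freq \<epsilon> \<le> 2 / \<omega> * x"
proof -
  have "x / freq \<epsilon> \<le> x / (\<omega> / 2)"
    using freq_bounds(1)[OF assms(1)] \<omega>_pos assms by (intro divide_left_mono) auto
  then show ?thesis by (simp add: field_simps)
qed

lemma abs_detuning_le:
  assumes "small \<epsilon>"
  shows "\<bar>detuning \<epsilon>\<bar> \<le> 2 * \<omega> * \<bar>\<sigma>\<bar> + \<sigma>\<^sup>2"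
proof -
  have "\<bar>2 * \<omega> * \<sigma>\<bar> = 2 * \<omega> * \<bar>\<sigma>\<bar>"
    using \<omega>_pos by (simp add: abs_mult)
  moreover have "\<bar>\<epsilon> * \<sigma>\<^sup>2\<bar> \<le> \<sigma>\<^sup>2"
    using assms by (auto simp: small_def abs_mult intro: mult_left_le_one_le)
  ultimately show ?thesis
    unfolding detuning_def by linarith
qed

lemma freq_squared: "(freq \<epsilon>)\<^sup>2 - \<omega>\<^sup>2 = \<epsilon> * detuning \<epsilon>"
  by (simp add: freq_def detuning_def power2_eq_square algebra_simps)

section \<open>Size and Lipschitz bounds for the fields, uniform in \<epsilon> and time\<close>

lemma force_bounded:
  obtains M where "0 \<le> M" and "\<And>\<epsilon> t \<zeta>. small \<epsilon> \<Longrightarrow> norm \<zeta> \<le> R \<Longrightarrow> \<bar>force \<epsilon> t \<zeta>\<bar> \<le> M"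
proof
  let ?M = "(2 * \<omega> * \<bar>\<sigma>\<bar> + \<sigma>\<^sup>2) * \<bar>R\<bar> + \<bar>F\<bar> + \<bar>lam\<bar> * (2 * \<omega>) * \<bar>R\<bar> + \<bar>c\<bar> * \<bar>R\<bar>\<^sup>2 + \<bar>d\<bar> * \<bar>R\<bar> ^ 3"
  show "0 \<le> ?M"
    using \<omega>_pos by (intro add_nonneg_nonneg mult_nonneg_nonneg) auto
  show "\<bar>force \<epsilon> t \<zeta>\<bar> \<le> ?M" if "small \<epsilon>" "norm \<zeta> \<le> R" for \<epsilon> t \<zeta>
  proof -
    have ReIm: "\<bar>Re \<zeta>\<bar> \<le> \<bar>R\<bar>" "\<bar>Im \<zeta>\<bar> \<le> \<bar>R\<bar>"
      using abs_Re_le_cmod[of \<zeta>] abs_Im_le_cmod[of \<zeta>] that by linarith+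
    have "\<bar>detuning \<epsilon> * Re \<zeta>\<bar> \<le> (2 * \<omega> * \<bar>\<sigma>\<bar> + \<sigma>\<^sup>2) * \<bar>R\<bar>"
      unfolding abs_mult using abs_detuning_le[OF that(1)] ReIm \<omega>_pos by (intro mult_mono) auto
    moreover have "\<bar>F * cos (freq \<epsilon> * t)\<bar> \<le> \<bar>F\<bar>"
      by (simp add: abs_mult mult_left_le)
    moreover have "\<bar>lam * freq \<epsilon> * Im \<zeta>\<bar> \<le> \<bar>lam\<bar> * (2 * \<omega>) * \<bar>R\<bar>"
      unfolding abs_mult using freq_bounds[OF that(1)] freq_pos[OF that(1)] ReIm \<omega>_pos
      by (intro mult_mono) auto
    moreover have "\<bar>c * (Re \<zeta>)\<^sup>2\<bar> \<le> \<bar>c\<bar> * \<bar>R\<bar>\<^sup>2"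
      unfolding abs_mult power_abs using power_mono[OF ReIm(1), of 2] by (intro mult_left_mono) auto
    moreover have "\<bar>d * Re \<zeta> ^ 3\<bar> \<le> \<bar>d\<bar> * \<bar>R\<bar> ^ 3"
      unfolding abs_mult power_abs using ReIm by (intro mult_left_mono power_mono) auto
    ultimately show ?thesis
      unfolding force_def by (rule abs_sum5_le)
  qed
qed

lemma force_lipschitz:
  obtains L where "0 \<le> L" and "\<And>\<epsilon> t \<zeta> \<eta>. small \<epsilon> \<Longrightarrow> norm \<zeta> \<le> R \<Longrightarrow> norm \<eta> \<le> R \<Longrightarrow>
    \<bar>force \<epsilon> t \<zeta> - force \<epsilon> t \<eta>\<bar> \<le> L * norm (\<zeta> - \<eta>)"
proof
  let ?L = "(2 * \<omega> * \<bar>\<sigma>\<bar> + \<sigma>\<^sup>2) + \<bar>lam\<bar> * (2 * \<omega>) + \<bar>c\<bar> * (2 * \<bar>R\<bar>) + \<bar>d\<bar> * (3 * \<bar>R\<bar>\<^sup>2)"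
  show "0 \<le> ?L"
    using \<omega>_pos by (intro add_nonneg_nonneg mult_nonneg_nonneg) auto
  show "\<bar>force \<epsilon> t \<zeta> - force \<epsilon> t \<eta>\<bar> \<le> ?L * norm (\<zeta> - \<eta>)"
    if "small \<epsilon>" "norm \<zeta> \<le> R" "norm \<eta> \<le> R" for \<epsilon> t \<zeta> \<eta>
  proof -
    define x y where "x = Re \<zeta>" "y = Re \<eta>"
    define \<delta> where "\<delta> = norm (\<zeta> - \<eta>)"
    have xy: "\<bar>x\<bar> \<le> \<bar>R\<bar>" "\<bar>y\<bar> \<le> \<bar>R\<bar>"
      using abs_Re_le_cmod[of \<zeta>] abs_Re_le_cmod[of \<eta>] that by (auto simp: x_y_def)
    have dx: "\<bar>x - y\<bar> \<le> \<delta>" and dy: "\<bar>Im \<zeta> - Im \<eta>\<bar> \<le> \<delta>"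
      using abs_Re_le_cmod[of "\<zeta> - \<eta>"] abs_Im_le_cmod[of "\<zeta> - \<eta>"] by (auto simp: x_y_def \<delta>_def)
    have "\<bar>detuning \<epsilon> * (x - y)\<bar> \<le> (2 * \<omega> * \<bar>\<sigma>\<bar> + \<sigma>\<^sup>2) * \<delta>"
      unfolding abs_mult using abs_detuning_le[OF that(1)] dx \<omega>_pos by (intro mult_mono) auto
    moreover have "\<bar>lam * freq \<epsilon> * (Im \<zeta> - Im \<eta>)\<bar> \<le> \<bar>lam\<bar> * (2 * \<omega>) * \<delta>"
      unfolding abs_mult using freq_bounds[OF that(1)] freq_pos[OF that(1)] dy \<omega>_pos
      by (intro mult_mono) auto
    moreover have "\<bar>c * ((x + y) * (x - y))\<bar> \<le> \<bar>c\<bar> * (2 * \<bar>R\<bar> * \<delta>)"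
      unfolding abs_mult using xy dx by (intro mult_mono) auto
    moreover have "\<bar>d * ((x\<^sup>2 + x * y + y\<^sup>2) * (x - y))\<bar> \<le> \<bar>d\<bar> * (3 * \<bar>R\<bar>\<^sup>2 * \<delta>)"
    proof -
      have "\<bar>x\<^sup>2\<bar> \<le> \<bar>R\<bar>\<^sup>2" "\<bar>y\<^sup>2\<bar> \<le> \<bar>R\<bar>\<^sup>2" "\<bar>x * y\<bar> \<le> \<bar>R\<bar>\<^sup>2"
        using mult_mono[OF xy] mult_mono[OF xy(1) xy(1)] mult_mono[OF xy(2) xy(2)]
        by (auto simp: abs_mult power2_eq_square)
      then have "\<bar>x\<^sup>2 + x * y + y\<^sup>2\<bar> \<le> 3 * \<bar>R\<bar>\<^sup>2"
        by linarith
      with dx show ?thesis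
        unfolding abs_mult by (intro mult_mono) auto
    qed
    \<comment> \<open>The \<open>0\<close> fills the slot of the forcing term, which does not depend
      on the state and cancels; with it the five-term bound fits.\<close>
    ultimately have "\<bar>detuning \<epsilon> * (x - y) + 0 + lam * freq \<epsilon> * (Im \<zeta> - Im \<eta>)
        - c * ((x + y) * (x - y)) - d * ((x\<^sup>2 + x * y + y\<^sup>2) * (x - y))\<bar>
      \<le> (2 * \<omega> * \<bar>\<sigma>\<bar> + \<sigma>\<^sup>2) * \<delta> + 0 + \<bar>lam\<bar> * (2 * \<omega>) * \<delta> + \<bar>c\<bar> * (2 * \<bar>R\<bar> * \<delta>) + \<bar>d\<bar> * (3 * \<bar>R\<bar>\<^sup>2 * \<delta>)"
      by (intro abs_sum5_le) (assumption | simp only: abs_zero order_refl)+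
    also have "\<dots> = ?L * norm (\<zeta> - \<eta>)"
      unfolding \<delta>_def by (simp only: distrib_right mult.assoc add_0_right)
    also have "detuning \<epsilon> * (x - y) + 0 + lam * freq \<epsilon> * (Im \<zeta> - Im \<eta>) - c * ((x + y) * (x - y))
        - d * ((x\<^sup>2 + x * y + y\<^sup>2) * (x - y)) = force \<epsilon> t \<zeta> - force \<epsilon> t \<eta>"
      by (simp add: force_def x_y_def algebra_simps power2_eq_square power3_eq_cube)
    finally show ?thesis .
  qed
qed

text \<open>The rotations have modulus one, so bounds for \<open>force\<close> on a ball pass to the
  envelope field. The constant is independent of \<epsilon> and of time, which is what permits
  \<gamma> to be fixed before \<epsilon>.\<close>

lemma fast_field_bounds:
  obtains M where "0 \<le> M"
    and "\<And>\<epsilon> t z. small \<epsilon> \<Longrightarrow> norm z \<le> R \<Longrightarrow> norm (fast_field \<epsilon> t z) \<le> M"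
    and "\<And>\<epsilon> t z y. small \<epsilon> \<Longrightarrow> norm z \<le> R \<Longrightarrow> norm y \<le> R \<Longrightarrow>
      norm (fast_field \<epsilon> t z - fast_field \<epsilon> t y) \<le> M * norm (z - y)"
proof -
  obtain M where M: "0 \<le> M" "\<And>\<epsilon> t \<zeta>. small \<epsilon> \<Longrightarrow> norm \<zeta> \<le> R \<Longrightarrow> \<bar>force \<epsilon> t \<zeta>\<bar> \<le> M"
    by (rule force_bounded[of R]) (rule that; blast)
  obtain L where L: "0 \<le> L" "\<And>\<epsilon> t \<zeta> \<eta>. small \<epsilon> \<Longrightarrow> norm \<zeta> \<le> R \<Longrightarrow> norm \<eta> \<le> R \<Longrightarrow>
      \<bar>force \<epsilon> t \<zeta> - force \<epsilon> t \<eta>\<bar> \<le> L * norm (\<zeta> - \<eta>)"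
    by (rule force_lipschitz[of R]) (rule that; blast)
  show thesis
  proof
    show "0 \<le> 2 / \<omega> * (M + L)"
      using M L \<omega>_pos by simp
    show "norm (fast_field \<epsilon> t z) \<le> 2 / \<omega> * (M + L)" if "small \<epsilon>" "norm z \<le> R" for \<epsilon> t z
    proof -
      have "norm (fast_field \<epsilon> t z) = \<bar>force \<epsilon> t (z * cis (freq \<epsilon> * t))\<bar> / freq \<epsilon>"
        using freq_pos[OF that(1)] by (simp add: fast_field_def norm_mult norm_divide)
      also have "\<dots> \<le> 2 / \<omega> * \<bar>force \<epsilon> t (z * cis (freq \<epsilon> * t))\<bar>"
        by (rule inverse_freq_bound[OF that(1)]) simp
      also have "\<dots> \<le> 2 / \<omega> * (M + L)"
        using M(2)[OF that(1), of "z * cis (freq \<epsilon> * t)" t] that L \<omega>_pos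
        by (intro mult_left_mono) (auto simp: norm_mult)
      finally show ?thesis .
    qed
    show "norm (fast_field \<epsilon> t z - fast_field \<epsilon> t y) \<le> 2 / \<omega> * (M + L) * norm (z - y)"
      if "small \<epsilon>" "norm z \<le> R" "norm y \<le> R" for \<epsilon> t z y
    proof -
      let ?f = "\<lambda>z. force \<epsilon> t (z * cis (freq \<epsilon> * t))"
      have "fast_field \<epsilon> t z - fast_field \<epsilon> t y
          = - (\<i> / of_real (freq \<epsilon>)) * (of_real (?f z - ?f y) * cis (- (freq \<epsilon> * t)))"
        by (simp add: fast_field_def algebra_simps)
      then have "norm (fast_field \<epsilon> t z - fast_field \<epsilon> t y) = \<bar>?f z - ?f y\<bar> / freq \<epsilon>"
        using freq_pos[OF that(1)] by (simp add: norm_mult norm_divide del: of_real_diff)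
      also have "\<dots> \<le> 2 / \<omega> * \<bar>?f z - ?f y\<bar>"
        by (rule inverse_freq_bound[OF that(1)]) simp
      also have "\<dots> \<le> 2 / \<omega> * (L * norm (z * cis (freq \<epsilon> * t) - y * cis (freq \<epsilon> * t)))"
        using that \<omega>_pos by (intro mult_left_mono L(2)) (auto simp: norm_mult)
      also have "\<dots> = 2 / \<omega> * (L * norm (z - y))"
        by (simp add: left_diff_distrib[symmetric] norm_mult)
      also have "\<dots> \<le> 2 / \<omega> * ((M + L) * norm (z - y))"
        using M \<omega>_pos by (intro mult_left_mono mult_right_mono) auto
      finally show ?thesis
        by (simp only: mult.assoc)
    qed
  qed
qed

lemma slow_field_bounds:
  obtains M where "0 \<le> M"
    and "\<And>z. norm z \<le> R \<Longrightarrow> norm (slow_field z) \<le> M"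
    and "\<And>z y. norm z \<le> R \<Longrightarrow> norm y \<le> R \<Longrightarrow>
      norm (slow_field z - slow_field y) \<le> M * norm (z - y)"
proof -
  define K where "K = \<bar>R\<bar>"
  have "0 \<le> K"
    by (simp add: K_def)
  define L where "L = norm (- (\<i> / (2 * of_real \<omega>))) *
    (\<bar>lam * \<omega>\<bar> + \<bar>2 * \<sigma> * \<omega>\<bar> + \<bar>3 * d / 4\<bar> * (3 * K\<^sup>2))"
  have "0 \<le> L"
    unfolding L_def using \<open>0 \<le> K\<close> by (intro mult_nonneg_nonneg add_nonneg_nonneg) auto
  have lip: "norm (slow_field z - slow_field y) \<le> L * norm (z - y)"
    if "norm z \<le> R" "norm y \<le> R" for z y
  proof -
    have R: "norm z \<le> K" "norm y \<le> K"
      using that by (auto simp: K_def)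
    \<comment> \<open>Telescoping: the conjugated factor is changed first, then the square.\<close>
    have "z * z * cnj z - y * y * cnj y = z * z * cnj (z - y) + (z + y) * cnj y * (z - y)"
      by (simp add: algebra_simps)
    moreover have "norm (z * z * cnj (z - y)) \<le> K * K * norm (z - y)"
      unfolding norm_mult complex_mod_cnj using R \<open>0 \<le> K\<close> by (intro mult_mono) auto
    moreover have "norm ((z + y) * cnj y * (z - y)) \<le> (2 * K) * K * norm (z - y)"
      unfolding norm_mult complex_mod_cnj using R \<open>0 \<le> K\<close> norm_triangle_ineq[of z y]
      by (intro mult_mono) auto
    ultimately have cubic: "norm (z * z * cnj z - y * y * cnj y) \<le> 3 * K\<^sup>2 * norm (z - y)"
      using norm_triangle_ineq[of "z * z * cnj (z - y)" "(z + y) * cnj y * (z - y)"]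
      by (simp add: power2_eq_square)
    have "slow_field z - slow_field y = - (\<i> / (2 * of_real \<omega>)) *
        (of_real (lam * \<omega>) * (- \<i> * (z - y)) + of_real (2 * \<sigma> * \<omega>) * (z - y)
         - of_real (3 * d / 4) * (z * z * cnj z - y * y * cnj y))"
      by (simp add: slow_field_def algebra_simps)
    also have "norm \<dots> \<le> norm (- (\<i> / (2 * of_real \<omega>))) *
        (\<bar>lam * \<omega>\<bar> * norm (z - y) + \<bar>2 * \<sigma> * \<omega>\<bar> * norm (z - y)
         + \<bar>3 * d / 4\<bar> * (3 * K\<^sup>2 * norm (z - y)))"
      (is "norm (?k * (?A + ?B - ?C)) \<le> norm ?k * (?a + ?b + ?c)")
    proof -
      have "norm ?A = ?a" "norm ?B = ?b"
        by (auto simp: norm_mult abs_mult)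
      moreover have "norm ?C \<le> ?c"
        unfolding norm_mult norm_of_real by (intro mult_left_mono cubic) auto
      ultimately have "norm (?A + ?B - ?C) \<le> ?a + ?b + ?c"
        using norm_triangle_ineq4[of "?A + ?B" ?C] norm_triangle_ineq[of ?A ?B] by linarith
      then show ?thesis
        unfolding norm_mult[of ?k] by (rule mult_left_mono) simp
    qed
    finally show ?thesis
      by (simp add: L_def algebra_simps)
  qed
  show thesis
  proof
    \<comment> \<open>\<open>K + 1\<close> in place of \<open>K\<close> makes the constant dominate
      \<open>L\<close> as well as \<open>L * K\<close>; the value at 0 turns the Lipschitz estimate
      into a size estimate.\<close>
    show "0 \<le> L * (K + 1) + norm (slow_field 0)"
      using \<open>0 \<le> L\<close> \<open>0 \<le> K\<close> by simp
    show "norm (slow_field z) \<le> L * (K + 1) + norm (slow_field 0)" if "norm z \<le> R" for z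
    proof -
      have "norm (slow_field z - slow_field 0) \<le> L * norm (z - 0)"
        using that order_trans[OF norm_ge_zero that] by (intro lip) simp_all
      also have "\<dots> \<le> L * (K + 1)"
        using that \<open>0 \<le> L\<close> by (intro mult_left_mono) (auto simp: K_def)
      finally show ?thesis
        using norm_triangle_ineq2[of "slow_field z" "slow_field 0"] by linarith
    qed
    show "norm (slow_field z - slow_field y) \<le> (L * (K + 1) + norm (slow_field 0)) * norm (z - y)"
      if "norm z \<le> R" "norm y \<le> R" for z y
    proof -
      have "L \<le> L * (K + 1) + norm (slow_field 0)"
        using \<open>0 \<le> L\<close> \<open>0 \<le> K\<close> by (simp add: algebra_simps add_nonneg_nonneg)
      then show ?thesis
        using lip[OF that] mult_right_mono[of L _ "norm (z - y)"] by (meson norm_ge_zero order_trans)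
    qed
  qed
qed

section \<open>The mean compared with the slow field, and the oscillating rest\<close>

lemma mean_field_slow_field:
  obtains C where "0 \<le> C"
    and "\<And>\<epsilon> z. small \<epsilon> \<Longrightarrow> norm z \<le> R \<Longrightarrow> norm (mean_field \<epsilon> z - slow_field z) \<le> \<epsilon> * C"
proof -
  define K where "K = \<bar>R\<bar>"
  have "0 \<le> K"
    by (simp add: K_def)
  let ?N = "\<bar>F / 2\<bar> + \<bar>3 * d / 8\<bar> * (K * K * K)"
  let ?C = "2 / \<omega> * (\<bar>\<sigma>\<bar> / \<omega> * ?N + \<sigma>\<^sup>2 / 2 * K)"
  have C: "0 \<le> ?C"
    using \<omega>_pos \<open>0 \<le> K\<close> by simp
  have bound: "norm (mean_field \<epsilon> z - slow_field z) \<le> \<epsilon> * ?C" if "small \<epsilon>" "norm z \<le> R" for \<epsilon> z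
  proof -
    \<comment> \<open>The damping terms of the two fields agree exactly. \<open>N\<close> collects
      forcing and cubic terms, whose prefactors differ by \<open>1 / \<omega> - 1 / freq \<epsilon>
      = \<epsilon> * \<sigma> / (\<omega> * freq \<epsilon>)\<close>; the detuning terms leave
      \<open>\<sigma>\<^sup>2 / 2 * z\<close>. Hence the difference of the fields is exactly
      \<open>\<i> * \<epsilon> * w / freq \<epsilon>\<close>.\<close>
    define N :: complex where "N = of_real (F / 2) - of_real (3 * d / 8) * (z * z * cnj z)"
    define w :: complex where "w = of_real (\<sigma> / \<omega>) * N + of_real (\<sigma>\<^sup>2 / 2) * z"
    have R: "norm z \<le> K"
      using that by (simp add: K_def)
    have "norm (of_real (3 * d / 8) * (z * z * cnj z)) \<le> \<bar>3 * d / 8\<bar> * (K * K * K)"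
      unfolding norm_mult norm_of_real complex_mod_cnj using R \<open>0 \<le> K\<close>
      by (intro mult_left_mono mult_mono mult_nonneg_nonneg) auto
    then have "norm N \<le> ?N"
      unfolding N_def by (intro order_trans[OF norm_triangle_ineq4] add_mono) auto
    then have "norm (of_real (\<sigma> / \<omega>) * N) \<le> \<bar>\<sigma>\<bar> / \<omega> * ?N"
      unfolding norm_mult norm_of_real using \<omega>_pos by (intro mult_mono) auto
    moreover have "norm (of_real (\<sigma>\<^sup>2 / 2) * z) \<le> \<sigma>\<^sup>2 / 2 * K"
      unfolding norm_mult norm_of_real using R by (intro mult_mono) auto
    ultimately have w: "norm w \<le> \<bar>\<sigma>\<bar> / \<omega> * ?N + \<sigma>\<^sup>2 / 2 * K"
      unfolding w_def by (rule order_trans[OF norm_triangle_ineq add_mono])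
    have nz: "complex_of_real \<omega> \<noteq> 0" "complex_of_real (freq \<epsilon>) \<noteq> 0"
      using \<omega>_pos freq_pos[OF that(1)] by auto
    have "mean_field \<epsilon> z - slow_field z = \<i> * of_real \<epsilon> * w / of_real (freq \<epsilon>)"
      using nz unfolding mean_field_def slow_field_def w_def N_def detuning_def
      apply (simp add: divide_simps)
      apply (simp add: freq_def algebra_simps power2_eq_square)
      done
    then have "norm (mean_field \<epsilon> z - slow_field z) = \<epsilon> * (norm w / freq \<epsilon>)"
      using that freq_pos[OF that(1)] by (simp add: norm_mult norm_divide small_def)
    also have "\<dots> \<le> \<epsilon> * (2 / \<omega> * norm w)"
      using that by (intro mult_left_mono inverse_freq_bound) (auto simp: small_def)
    also have "\<dots> \<le> \<epsilon> * ?C"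
      using w that \<omega>_pos by (intro mult_left_mono) (auto simp: small_def)
    finally show ?thesis .
  qed
  show thesis
    by (rule that[OF C bound])
qed

text \<open>Euler's formulas turn the real part, the imaginary part and the cosine in
  \<open>force\<close> into polynomials in \<open>E\<close> and its conjugate, after which
  \<open>forcing_expansion\<close> applies.\<close>

lemma fast_field_decomposition:
  "fast_field \<epsilon> t z = mean_field \<epsilon> z + oscillating_field \<epsilon> t z"
proof -
  define E E' where "E = cis (freq \<epsilon> * t)" "E' = cis (- (freq \<epsilon> * t))"
  have EE': "E * E' = 1"
    by (simp add: E_E'_def cis_mult)
  have pow: "cis (1 * freq \<epsilon> * t) = E" "cis (2 * freq \<epsilon> * t) = E ^ 2" "cis ((- 1) * freq \<epsilon> * t) = E'"
    "cis ((- 2) * freq \<epsilon> * t) = E' ^ 2" "cis ((- 3) * freq \<epsilon> * t) = E' ^ 3"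
    "cis ((- 4) * freq \<epsilon> * t) = E' ^ 4"
    by (simp_all add: E_E'_def Complex.DeMoivre mult.assoc)
  have cnjE: "cnj E = E'"
    by (simp add: E_E'_def cis_cnj)
  have Re: "complex_of_real (Re (z * E)) = (z * E + cnj z * E') / 2"
    using complex_add_cnj[of "z * E"] by (simp add: cnjE)
  have Im: "complex_of_real (Im (z * E)) = (z * E - cnj z * E') / (2 * \<i>)"
  proof -
    have "complex_of_real (Im w) = (w - cnj w) / (2 * \<i>)" for w
      by (simp add: complex_eq_iff)
    from this[of "z * E"] show ?thesis
      by (simp only: complex_cnj_mult cnjE)
  qed
  have cos: "complex_of_real (cos (freq \<epsilon> * t)) = (E + E') / 2"
    using complex_add_cnj[of E] unfolding cnjE by (simp add: E_E'_def)
  note expansion = forcing_expansion[OF EE', of "of_real (detuning \<epsilon>)" z "cnj z" "of_real F"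
      "of_real lam * of_real (freq \<epsilon>)" "of_real c" "of_real d", folded Re Im cos]
  have "of_real (force \<epsilon> t (z * E)) * E' = (complex_of_real (detuning \<epsilon>) * of_real (Re (z * E))
      + of_real F * of_real (cos (freq \<epsilon> * t)) + of_real lam * of_real (freq \<epsilon>) * of_real (Im (z * E))
      - of_real c * of_real (Re (z * E)) ^ 2 - of_real d * of_real (Re (z * E)) ^ 3) * E'"
    by (simp add: force_def)
  then show ?thesis
    unfolding fast_field_def mean_field_def oscillating_field_def pow E_E'_def[symmetric]
    by (simp only: expansion distrib_left)
qed

text \<open>Because \<open>1 \<le> \<bar>k\<bar>\<close>, the frequency of the harmonic is in
  modulus at least \<open>freq \<epsilon> \<ge> \<omega> / 2\<close>: no small divisor appears as
  \<epsilon> tends to 0.\<close>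

lemma averages_out_cis_freq:
  assumes "small \<epsilon>" "slowly_varying \<epsilon> S B x" "0 \<le> B" "1 \<le> \<bar>k\<bar>" "norm q \<le> Q"
  shows "averages_out \<epsilon> S (Q * (2 / \<omega> * B)) (\<lambda>t. q * (x t * cis (k * freq \<epsilon> * t)))"
proof (rule averages_out_mono)
  have fp: "0 < freq \<epsilon>"
    using assms(1) by (rule freq_pos)
  have "k * freq \<epsilon> \<noteq> 0"
    using fp assms(4) by auto
  then show "averages_out \<epsilon> S (norm q * (B / \<bar>k * freq \<epsilon>\<bar>)) (\<lambda>t. q * (x t * cis (k * freq \<epsilon> * t)))"
    by (intro averages_out_cmult averages_out_cis assms(2))
  have "B / \<bar>k * freq \<epsilon>\<bar> \<le> B / freq \<epsilon>"
    using fp assms(3,4) by (intro divide_left_mono) (auto simp: abs_mult)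
  also have "\<dots> \<le> 2 / \<omega> * B"
    using assms by (intro inverse_freq_bound)
  finally show "norm q * (B / \<bar>k * freq \<epsilon>\<bar>) \<le> Q * (2 / \<omega> * B)"
    using assms(3,5) norm_ge_zero[of q] by (intro mult_mono) (auto simp del: norm_ge_zero)
qed (use assms(1) in \<open>simp add: small_def\<close>)

lemma oscillating_field_averages_out:
  assumes "0 \<le> B"
  obtains M where "0 \<le> M"
    and "\<And>\<epsilon> S z. small \<epsilon> \<Longrightarrow> slowly_varying \<epsilon> S B z \<Longrightarrow>
      averages_out \<epsilon> S M (\<lambda>t. oscillating_field \<epsilon> t (z t))"
proof -
  \<comment> \<open>\<open>B2\<close> and \<open>B3\<close> are the constants that
    \<open>slowly_varying_mult\<close> yields for products of two and of three factors.\<close>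
  define B2 where "B2 = 2 * B * B"
  define B3 where "B3 = 2 * B2 * B"
  have B: "0 \<le> B2" "0 \<le> B3"
    using assms by (auto simp: B2_def B3_def)
  define D where "D = 2 * \<omega> * \<bar>\<sigma>\<bar> + \<sigma>\<^sup>2 + \<bar>lam\<bar> * (2 * \<omega>)"
  have "0 \<le> D"
    using \<omega>_pos by (simp add: D_def)
  define M where "M = \<bar>c\<bar> * (2 / \<omega> * B2) + (\<bar>d\<bar> * (2 / \<omega> * B3) + (\<bar>c\<bar> * (2 / \<omega> * B2) + (D * (2 / \<omega> * B)
    + (\<bar>F\<bar> * (2 / \<omega> * 1) + (\<bar>d\<bar> * (2 / \<omega> * B3) + (\<bar>c\<bar> * (2 / \<omega> * B2) + \<bar>d\<bar> * (2 / \<omega> * B3)))))))"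
  have "0 \<le> M"
    unfolding M_def using B \<open>0 \<le> D\<close> \<omega>_pos assms
    by (intro add_nonneg_nonneg mult_nonneg_nonneg) auto
  show thesis
  proof
    show "0 \<le> 2 / \<omega> * M"
      using \<open>0 \<le> M\<close> \<omega>_pos by simp
    fix \<epsilon> :: real and S z
    assume \<epsilon>: "small \<epsilon>" and z: "slowly_varying \<epsilon> S B z"
    have \<epsilon>0: "0 \<le> \<epsilon>"
      using \<epsilon> by (simp add: small_def)
    note z' = slowly_varying_cnj[OF z]
    note mult = slowly_varying_mult[OF \<epsilon>0]
    have D: "norm (of_real (detuning \<epsilon>) / 2 + \<i> * (of_real lam * of_real (freq \<epsilon>)) / 2) \<le> D"
    proof -
      have "norm (of_real (detuning \<epsilon>) / 2 + \<i> * (of_real lam * of_real (freq \<epsilon>)) / 2) \<le> \<bar>detuning \<epsilon>\<bar> + \<bar>lam\<bar> * \<bar>freq \<epsilon>\<bar>"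
        by (intro order_trans[OF norm_triangle_ineq] add_mono) (auto simp: norm_mult norm_divide)
      also have "\<dots> \<le> D"
        unfolding D_def using abs_detuning_le[OF \<epsilon>] freq_bounds[OF \<epsilon>] freq_pos[OF \<epsilon>]
        by (intro add_mono mult_left_mono) auto
      finally show ?thesis .
    qed
    \<comment> \<open>One integration by parts per harmonic. Numerical factors such as 1/4 or 3/8
      are bounded by 1, hence the plain \<open>\<bar>c\<bar>\<close>, \<open>\<bar>d\<bar>\<close>
      and \<open>\<bar>F\<bar>\<close>.\<close>
    have t1: "averages_out \<epsilon> S (\<bar>c\<bar> * (2 / \<omega> * B2)) (\<lambda>t. - of_real c / 4 * (z t * z t * cis (1 * freq \<epsilon> * t)))"
      by (rule averages_out_cis_freq[OF \<epsilon> mult[OF z z, folded B2_def] B(1)]) (use D in \<open>auto simp: norm_divide norm_mult\<close>)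
    have t2: "averages_out \<epsilon> S (\<bar>d\<bar> * (2 / \<omega> * B3)) (\<lambda>t. - of_real d / 8 * (z t * z t * z t * cis (2 * freq \<epsilon> * t)))"
      by (rule averages_out_cis_freq[OF \<epsilon> mult[OF mult[OF z z] z, folded B2_def, folded B3_def] B(2)]) (use D in \<open>auto simp: norm_divide norm_mult\<close>)
    have t3: "averages_out \<epsilon> S (\<bar>c\<bar> * (2 / \<omega> * B2)) (\<lambda>t. - of_real c / 2 * (z t * cnj (z t) * cis ((- 1) * freq \<epsilon> * t)))"
      by (rule averages_out_cis_freq[OF \<epsilon> mult[OF z z', folded B2_def] B(1)]) (use D in \<open>auto simp: norm_divide norm_mult\<close>)
    have t4: "averages_out \<epsilon> S (D * (2 / \<omega> * B)) (\<lambda>t. (of_real (detuning \<epsilon>) / 2 + \<i> * (of_real lam * of_real (freq \<epsilon>)) / 2) * (cnj (z t) * cis ((- 2) * freq \<epsilon> * t)))"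
      by (rule averages_out_cis_freq[OF \<epsilon> z' assms]) (use D in \<open>auto simp: norm_divide norm_mult\<close>)
    have t5: "averages_out \<epsilon> S (\<bar>F\<bar> * (2 / \<omega> * 1)) (\<lambda>t. of_real F / 2 * (1 * cis ((- 2) * freq \<epsilon> * t)))"
      by (rule averages_out_cis_freq[OF \<epsilon> slowly_varying_const[OF \<epsilon>0, of 1 1] zero_le_one]) (use D in \<open>auto simp: norm_divide norm_mult\<close>)
    have t6: "averages_out \<epsilon> S (\<bar>d\<bar> * (2 / \<omega> * B3)) (\<lambda>t. - 3 * of_real d / 8 * (z t * cnj (z t) * cnj (z t) * cis ((- 2) * freq \<epsilon> * t)))"
      by (rule averages_out_cis_freq[OF \<epsilon> mult[OF mult[OF z z'] z', folded B2_def, folded B3_def] B(2)]) (use D in \<open>auto simp: norm_divide norm_mult\<close>)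
    have t7: "averages_out \<epsilon> S (\<bar>c\<bar> * (2 / \<omega> * B2)) (\<lambda>t. - of_real c / 4 * (cnj (z t) * cnj (z t) * cis ((- 3) * freq \<epsilon> * t)))"
      by (rule averages_out_cis_freq[OF \<epsilon> mult[OF z' z', folded B2_def] B(1)]) (use D in \<open>auto simp: norm_divide norm_mult\<close>)
    have t8: "averages_out \<epsilon> S (\<bar>d\<bar> * (2 / \<omega> * B3)) (\<lambda>t. - of_real d / 8 * (cnj (z t) * cnj (z t) * cnj (z t) * cis ((- 4) * freq \<epsilon> * t)))"
      by (rule averages_out_cis_freq[OF \<epsilon> mult[OF mult[OF z' z'] z', folded B2_def, folded B3_def] B(2)]) (use D in \<open>auto simp: norm_divide norm_mult\<close>)
    note averages_out_add[OF t1 averages_out_add[OF t2 averages_out_add[OF t3 averages_out_add[OF t4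
          averages_out_add[OF t5 averages_out_add[OF t6 averages_out_add[OF t7 t8]]]]]], folded M_def]
    then have "averages_out \<epsilon> S (norm (- (\<i> / of_real (freq \<epsilon>))) * M) (\<lambda>t. oscillating_field \<epsilon> t (z t))"
      unfolding oscillating_field_def by (rule averages_out_cmult)
    moreover have "norm (- (\<i> / of_real (freq \<epsilon>))) * M \<le> 2 / \<omega> * M"
      using inverse_freq_bound[OF \<epsilon> \<open>0 \<le> M\<close>] freq_pos[OF \<epsilon>] by (simp add: norm_divide)
    ultimately show "averages_out \<epsilon> S (2 / \<omega> * M) (\<lambda>t. oscillating_field \<epsilon> t (z t))"
      by (rule averages_out_mono[OF \<epsilon>0])
  qed
qed

subsection \<open>Averaging\<close>

text \<open>Once \<epsilon> times the near primitive of the oscillating part is subtracted, the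
  difference \<open>z - Z\<close> has a derivative bounded by \<epsilon> times the sum of an
  O(\<epsilon>) term and \<open>L * norm (z - Z)\<close>. Up to time
  \<open>\<gamma> / \<epsilon>\<close> its maximum \<open>m\<close> is thus at most O(\<epsilon>)
  plus \<open>L * \<gamma> * m\<close>, and \<open>L * \<gamma> \<le> 1 / 2\<close> absorbs the last
  term. \<open>K\<close> precedes \<epsilon>, \<open>z\<close> and \<open>Z\<close> among the
  quantifiers, so it is uniform.\<close>

lemma averaging_estimate:
  assumes "0 \<le> \<gamma>" "0 \<le> L" "L * \<gamma> \<le> 1 / 2"
    and lip: "\<And>z y. norm z \<le> R \<Longrightarrow> norm y \<le> R \<Longrightarrow>
      norm (slow_field z - slow_field y) \<le> L * norm (z - y)"
  shows "\<exists>K. \<forall>\<epsilon> z Z. small \<epsilon> \<longrightarrow>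
      (\<forall>t\<in>{0..\<gamma> / \<epsilon>}. (z has_vector_derivative of_real \<epsilon> * fast_field \<epsilon> t (z t)) (at t within {0..\<gamma> / \<epsilon>})
        \<and> norm (z t) \<le> R) \<longrightarrow>
      (\<forall>t\<in>{0..\<gamma> / \<epsilon>}. (Z has_vector_derivative of_real \<epsilon> * slow_field (Z t)) (at t within {0..\<gamma> / \<epsilon>})
        \<and> norm (Z t) \<le> R) \<longrightarrow>
      norm (z 0 - Z 0) \<le> \<epsilon> * C\<^sub>0 \<longrightarrow> (\<forall>t\<in>{0..\<gamma> / \<epsilon>}. norm (z t - Z t) \<le> \<epsilon> * K)"
proof -
  obtain M\<^sub>1 where M1: "0 \<le> M\<^sub>1" "\<And>\<epsilon> t z. small \<epsilon> \<Longrightarrow> norm z \<le> R \<Longrightarrow> norm (fast_field \<epsilon> t z) \<le> M\<^sub>1"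
    by (rule fast_field_bounds[of R]) (rule that; blast)
  \<comment> \<open>\<open>R\<close> bounds the envelope and \<open>M\<^sub>1\<close> its derivative
    divided by \<epsilon>; the maximum serves both purposes of
    \<open>slowly_varying\<close>.\<close>
  define B where "B = max \<bar>R\<bar> M\<^sub>1"
  have B: "0 \<le> B" "R \<le> B" "M\<^sub>1 \<le> B"
    by (auto simp: B_def)
  obtain M where M: "0 \<le> M" "\<And>\<epsilon> S z. small \<epsilon> \<Longrightarrow> slowly_varying \<epsilon> S B z \<Longrightarrow>
      averages_out \<epsilon> S M (\<lambda>t. oscillating_field \<epsilon> t (z t))"
    using B(1) by (rule oscillating_field_averages_out) (rule that; blast)
  obtain C where C: "0 \<le> C"
    "\<And>\<epsilon> z. small \<epsilon> \<Longrightarrow> norm z \<le> R \<Longrightarrow> norm (mean_field \<epsilon> z - slow_field z) \<le> \<epsilon> * C"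
    by (rule mean_field_slow_field[of R]) (rule that; blast)
  show ?thesis
  proof (intro exI allI impI ballI)
    fix \<epsilon> t :: real and z Z :: "real \<Rightarrow> complex"
    define S where "S = {0..\<gamma> / \<epsilon>}"
    assume \<epsilon>: "small \<epsilon>"
      and z_sol: "\<forall>t\<in>{0..\<gamma> / \<epsilon>}. (z has_vector_derivative of_real \<epsilon> * fast_field \<epsilon> t (z t))
        (at t within {0..\<gamma> / \<epsilon>}) \<and> norm (z t) \<le> R"
      and Z_sol: "\<forall>t\<in>{0..\<gamma> / \<epsilon>}. (Z has_vector_derivative of_real \<epsilon> * slow_field (Z t))
        (at t within {0..\<gamma> / \<epsilon>}) \<and> norm (Z t) \<le> R"
      and init: "norm (z 0 - Z 0) \<le> \<epsilon> * C\<^sub>0" and "t \<in> {0..\<gamma> / \<epsilon>}"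
    then have t: "t \<in> S" by (simp add: S_def)
    have z: "(z has_vector_derivative of_real \<epsilon> * fast_field \<epsilon> s (z s)) (at s within S)" "norm (z s) \<le> R"
      and Z: "(Z has_vector_derivative of_real \<epsilon> * slow_field (Z s)) (at s within S)" "norm (Z s) \<le> R"
      if "s \<in> S" for s
      using z_sol Z_sol that unfolding S_def by blast+
    have \<epsilon>0: "0 < \<epsilon>"
      using \<epsilon> by (simp add: small_def)
    have S0: "0 \<in> S" and S_le: "\<epsilon> * s \<le> \<gamma>" "0 \<le> s" if "s \<in> S" for s
      using \<epsilon>0 \<open>0 \<le> \<gamma>\<close> that by (auto simp: S_def field_simps)
    have "slowly_varying \<epsilon> S B z"
      unfolding slowly_varying_def
    proof (intro exI ballI conjI)
      fix s assume s: "s \<in> S"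
      show "(z has_vector_derivative of_real \<epsilon> * fast_field \<epsilon> s (z s)) (at s within S)"
        using s by (rule z(1))
      show "norm (z s) \<le> B"
        using z(2)[OF s] B(2) by simp
      have "norm (fast_field \<epsilon> s (z s)) \<le> B"
        using M1(2)[OF \<epsilon> z(2)[OF s]] B(3) order_trans by blast
      then show "norm (of_real \<epsilon> * fast_field \<epsilon> s (z s)) \<le> \<epsilon> * B"
        using \<epsilon>0 by (simp add: norm_mult)
    qed
    then obtain V V' where V: "\<And>s. s \<in> S \<Longrightarrow> (V has_vector_derivative V' s) (at s within S)"
      "\<And>s. s \<in> S \<Longrightarrow> norm (V s) \<le> M"
      "\<And>s. s \<in> S \<Longrightarrow> norm (V' s - oscillating_field \<epsilon> s (z s)) \<le> \<epsilon> * M"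
      by (rule averages_outE[OF M(2)[OF \<epsilon>]]) (rule that; blast)
    have "continuous_on S (\<lambda>s. norm (z s - Z s))"
      using has_vector_derivative_continuous[OF z(1)] has_vector_derivative_continuous[OF Z(1)]
      by (intro continuous_intros) (simp_all add: continuous_on_eq_continuous_within)
    \<comment> \<open>Compactness gives a time of largest deviation; the integrated estimate is
      evaluated only there.\<close>
    then obtain s\<^sub>0 where s0: "s\<^sub>0 \<in> S" and s0_max: "\<And>s. s \<in> S \<Longrightarrow> norm (z s - Z s) \<le> norm (z s\<^sub>0 - Z s\<^sub>0)"
      using continuous_attains_sup[of S "\<lambda>s. norm (z s - Z s)"] t by (auto simp: S_def)
    define m where "m = norm (z s\<^sub>0 - Z s\<^sub>0)"
    define Q where "Q = \<epsilon> * C + L * m + \<epsilon> * M"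
    \<comment> \<open>Subtracting \<open>\<epsilon> * V\<close> cancels
      \<open>oscillating_field\<close> in the derivative up to order
      \<open>\<epsilon>\<^sup>2\<close>, at the price of a shift by at most
      \<open>\<epsilon> * M\<close> at each end.\<close>
    define y where "y s = z s - Z s - of_real \<epsilon> * V s" for s
    define y' where "y' s = of_real \<epsilon> * fast_field \<epsilon> s (z s) - of_real \<epsilon> * slow_field (Z s)
      - of_real \<epsilon> * V' s" for s
    have "norm (y s\<^sub>0 - y 0) \<le> (\<epsilon> * Q) * (s\<^sub>0 - 0)"
    proof (rule vector_derivative_norm_bound)
      fix s assume "s \<in> {0..\<gamma> / \<epsilon>}"
      then have s: "s \<in> S" by (simp add: S_def)
      show "(y has_vector_derivative y' s) (at s within {0..\<gamma> / \<epsilon>})"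
        unfolding S_def[symmetric] y_def[abs_def] y'_def
        by (intro has_vector_derivative_diff has_vector_derivative_mult_right z(1) Z(1) V(1) s)
      \<comment> \<open>Three small contributions: mean against slow field at the same point, the
        slow field at two nearby points, and the defect of the near primitive.\<close>
      have "y' s = of_real \<epsilon> * ((mean_field \<epsilon> (z s) - slow_field (z s)) + (slow_field (z s) - slow_field (Z s))
          - (V' s - oscillating_field \<epsilon> s (z s)))"
        by (simp add: y'_def fast_field_decomposition algebra_simps)
      then have "norm (y' s) = \<epsilon> * norm ((mean_field \<epsilon> (z s) - slow_field (z s))
          + (slow_field (z s) - slow_field (Z s)) - (V' s - oscillating_field \<epsilon> s (z s)))"
        using \<epsilon>0 by (simp add: norm_mult)
      also have "\<dots> \<le> \<epsilon> * Q"
      proof (rule mult_left_mono)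
        have "norm (slow_field (z s) - slow_field (Z s)) \<le> L * norm (z s - Z s)"
          by (rule lip[OF z(2)[OF s] Z(2)[OF s]])
        also have "\<dots> \<le> L * m"
          unfolding m_def by (rule mult_left_mono[OF s0_max[OF s] \<open>0 \<le> L\<close>])
        finally show "norm ((mean_field \<epsilon> (z s) - slow_field (z s))
            + (slow_field (z s) - slow_field (Z s)) - (V' s - oscillating_field \<epsilon> s (z s))) \<le> Q"
          (is "norm (?p + ?q - ?r) \<le> Q")
          unfolding Q_def using C(2)[OF \<epsilon> z(2)[OF s]] V(3)[OF s]
            norm_triangle_ineq4[of "?p + ?q" ?r] norm_triangle_ineq[of ?p ?q] by linarith
      qed (use \<epsilon>0 in simp)
      finally show "norm (y' s) \<le> \<epsilon> * Q" .
    qed (use s0 in \<open>simp add: S_def\<close>)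
    also have "\<dots> = Q * (\<epsilon> * s\<^sub>0)"
      by simp
    also have "\<dots> \<le> Q * \<gamma>"
    proof (rule mult_left_mono[OF S_le(1)[OF s0]])
      show "0 \<le> Q"
        unfolding Q_def m_def using \<epsilon>0 C(1) M(1) \<open>0 \<le> L\<close> by simp
    qed
    finally have "norm (y s\<^sub>0 - y 0) \<le> Q * \<gamma>" .
    moreover have "norm (of_real \<epsilon> * V s) \<le> \<epsilon> * M" if "s \<in> S" for s
      using \<epsilon>0 V(2)[OF that] by (simp add: norm_mult)
    note this[OF s0] this[OF S0[OF s0]]
    moreover have "m = norm ((y s\<^sub>0 - y 0) + (z 0 - Z 0) + of_real \<epsilon> * V s\<^sub>0 - of_real \<epsilon> * V 0)"
      (is "m = norm (?p + ?q + ?r - ?w)")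
      by (simp add: y_def m_def)
    ultimately have "m \<le> Q * \<gamma> + \<epsilon> * C\<^sub>0 + \<epsilon> * M + \<epsilon> * M"
      using init norm_triangle_ineq4[of "?p + ?q + ?r" ?w] norm_triangle_ineq[of "?p + ?q" ?r]
        norm_triangle_ineq[of ?p ?q] by linarith
    also have "\<dots> = \<epsilon> * (C\<^sub>0 + 2 * M + \<gamma> * (C + M)) + (L * \<gamma>) * m"
      by (simp add: Q_def algebra_simps)
    also have "\<dots> \<le> \<epsilon> * (C\<^sub>0 + 2 * M + \<gamma> * (C + M)) + 1 / 2 * m"
      using assms(3) by (intro add_left_mono mult_right_mono) (auto simp: m_def)
    finally have "m \<le> 2 * (\<epsilon> * (C\<^sub>0 + 2 * M + \<gamma> * (C + M)))"
      by linarith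
    then have "m \<le> \<epsilon> * (2 * (C\<^sub>0 + 2 * M + \<gamma> * (C + M)))"
      by (simp only: mult.left_commute)
    then show "norm (z t - Z t) \<le> \<epsilon> * (2 * (C\<^sub>0 + 2 * M + \<gamma> * (C + M)))"
      using s0_max[OF t] unfolding m_def by (rule order_trans[rotated])
  qed
qed

lemma phasor_has_vector_derivative:
  assumes "(z has_vector_derivative z') (at t within S)"
  shows "((\<lambda>t. z t * cis (freq \<epsilon> * t)) has_vector_derivative
    (z' + \<i> * of_real (freq \<epsilon>) * z t) * cis (freq \<epsilon> * t)) (at t within S)"
proof -
  have "((\<lambda>t. cis (freq \<epsilon> * t)) has_vector_derivative (\<i> * of_real (freq \<epsilon>) * cis (freq \<epsilon> * t))) (at t within S)"
    unfolding has_vector_derivative_def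
    by (auto intro!: derivative_eq_intros simp: scaleR_conv_of_real)
  from has_vector_derivative_mult[OF assms this] show ?thesis
    by (simp add: algebra_simps)
qed

subsection \<open>Passing to envelopes and back\<close>

text \<open>Because the velocity is scaled by \<open>freq \<epsilon>\<close> rather than by
  \<omega>, the harmonic terms cancel exactly when the envelope is differentiated, and the detuning
  moves into \<open>force\<close>. The powers of \<open>u\<close> in the equation combine with their
  coefficients to one factor \<open>\<epsilon>\<^sup>2\<close>.\<close>

lemma oscillator_solution_imp_envelope:
  assumes \<epsilon>: "small \<epsilon>" and t: "t \<in> I"
    and u: "\<And>t. t \<in> I \<Longrightarrow> (u has_real_derivative u' t) (at t within I)"
    and u': "\<And>t. t \<in> I \<Longrightarrow> (u' has_real_derivative u'' t) (at t within I)"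
    and ode: "\<And>t. t \<in> I \<Longrightarrow> u'' t + \<omega>\<^sup>2 * u t + \<epsilon> * lam * u' t + c * (u t)\<^sup>2 + d / \<epsilon> * u t ^ 3
            = \<epsilon>\<^sup>2 * F * cos ((\<omega> + \<epsilon> * \<sigma>) * t)"
    and z: "\<And>t. z t = Complex (u t / \<epsilon>) (- u' t / (\<epsilon> * freq \<epsilon>)) * cis (- (freq \<epsilon> * t))"
  shows "u t = \<epsilon> * Re (z t * cis (freq \<epsilon> * t))"
    and "u' t = - \<epsilon> * freq \<epsilon> * Im (z t * cis (freq \<epsilon> * t))"
    and "u'' t = \<epsilon>\<^sup>2 * force \<epsilon> t (z t * cis (freq \<epsilon> * t)) - (freq \<epsilon>)\<^sup>2 * u t"
    and "(z has_vector_derivative of_real \<epsilon> * fast_field \<epsilon> t (z t)) (at t within I)"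
proof -
  have \<epsilon>0: "0 < \<epsilon>"
    using \<epsilon> by (simp add: small_def)
  have fp: "0 < freq \<epsilon>"
    using \<epsilon> by (rule freq_pos)
  have zE: "z t * cis (freq \<epsilon> * t) = Complex (u t / \<epsilon>) (- u' t / (\<epsilon> * freq \<epsilon>))" for t
    by (simp add: z mult.assoc cis_mult)
  show "u t = \<epsilon> * Re (z t * cis (freq \<epsilon> * t))"
    using \<epsilon>0 unfolding zE by simp
  show "u' t = - \<epsilon> * freq \<epsilon> * Im (z t * cis (freq \<epsilon> * t))"
    using \<epsilon>0 fp unfolding zE by simp
  have "\<epsilon>\<^sup>2 * force \<epsilon> t (z t * cis (freq \<epsilon> * t))
      = (\<epsilon> * detuning \<epsilon>) * u t + \<epsilon>\<^sup>2 * F * cos (freq \<epsilon> * t) - \<epsilon> * lam * u' t - c * (u t)\<^sup>2 - d / \<epsilon> * u t ^ 3"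
    unfolding zE force_def using \<epsilon>0 fp by (simp add: field_simps power2_eq_square power3_eq_cube)
  then show accel: "u'' t = \<epsilon>\<^sup>2 * force \<epsilon> t (z t * cis (freq \<epsilon> * t)) - (freq \<epsilon>)\<^sup>2 * u t"
    using ode[OF t] unfolding freq_squared[symmetric] by (simp add: freq_def algebra_simps)
  have cis': "((\<lambda>t. cis (- (freq \<epsilon> * t))) has_vector_derivative
      (- \<i> * of_real (freq \<epsilon>) * cis (- (freq \<epsilon> * t)))) (at t within I)"
    unfolding has_vector_derivative_def
    by (auto intro!: derivative_eq_intros simp: scaleR_conv_of_real)
  have "((\<lambda>t. Complex (u t / \<epsilon>) (- u' t / (\<epsilon> * freq \<epsilon>))) has_vector_derivative
      Complex (u' t / \<epsilon>) (- u'' t / (\<epsilon> * freq \<epsilon>))) (at t within I)"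
    unfolding has_vector_derivative_complex_iff complex.sel
    by (intro conjI DERIV_cdivide DERIV_minus u u' t)
  from has_vector_derivative_mult[OF this cis']
  have "(z has_vector_derivative (Complex (u t / \<epsilon>) (- u' t / (\<epsilon> * freq \<epsilon>)) * (- \<i> * of_real (freq \<epsilon>))
      + Complex (u' t / \<epsilon>) (- u'' t / (\<epsilon> * freq \<epsilon>))) * cis (- (freq \<epsilon> * t))) (at t within I)"
    unfolding z[abs_def] by (simp add: algebra_simps)
  moreover have "Complex (u t / \<epsilon>) (- u' t / (\<epsilon> * freq \<epsilon>)) * (- \<i> * of_real (freq \<epsilon>))
      + Complex (u' t / \<epsilon>) (- u'' t / (\<epsilon> * freq \<epsilon>))
    = of_real \<epsilon> * (- (\<i> / of_real (freq \<epsilon>)) * of_real (force \<epsilon> t (z t * cis (freq \<epsilon> * t))))"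
    using \<epsilon>0 fp unfolding accel
    by (simp add: complex_eq_iff field_simps power2_eq_square)
  ultimately show "(z has_vector_derivative of_real \<epsilon> * fast_field \<epsilon> t (z t)) (at t within I)"
    unfolding fast_field_def by (simp only: mult.assoc)
qed

text \<open>In the rotated frame the forcing acts only on the imaginary part. The real part
  therefore has derivative exactly \<open>- \<Omega>\<close> times the imaginary part, which makes
  the latter the rescaled velocity.\<close>

lemma envelope_imp_oscillator_solution:
  assumes \<epsilon>: "small \<epsilon>"
    and z: "\<And>t. t \<in> I \<Longrightarrow> (z has_vector_derivative of_real \<epsilon> * fast_field \<epsilon> t (z t)) (at t within I)"
    and init: "z 0 = Complex (u\<^sub>0 / \<epsilon>) (- v\<^sub>0 / (\<epsilon> * freq \<epsilon>))"
  shows "oscillator_solution \<omega> lam c d F \<sigma> \<epsilon> I u\<^sub>0 v\<^sub>0 (\<lambda>t. \<epsilon> * Re (z t * cis (freq \<epsilon> * t)))"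
  unfolding oscillator_solution_def
proof (intro exI conjI ballI)
  have \<epsilon>0: "0 < \<epsilon>"
    using \<epsilon> by (simp add: small_def)
  have fp: "0 < freq \<epsilon>"
    using \<epsilon> by (rule freq_pos)
  fix t assume t: "t \<in> I"
  let ?f = "force \<epsilon> t (z t * cis (freq \<epsilon> * t))"
  have "(of_real \<epsilon> * fast_field \<epsilon> t (z t) + \<i> * of_real (freq \<epsilon>) * z t) * cis (freq \<epsilon> * t)
      = - (\<i> / of_real (freq \<epsilon>)) * (of_real \<epsilon> * of_real ?f) * (cis (- (freq \<epsilon> * t)) * cis (freq \<epsilon> * t))
        + \<i> * of_real (freq \<epsilon>) * (z t * cis (freq \<epsilon> * t))"
    unfolding fast_field_def by (simp only: ring_distribs mult_ac)
  also have "\<dots> = \<i> * of_real (freq \<epsilon>) * (z t * cis (freq \<epsilon> * t)) - \<i> * of_real (\<epsilon> * ?f / freq \<epsilon>)"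
    by (simp add: cis_mult)
  finally have "((\<lambda>t. z t * cis (freq \<epsilon> * t)) has_vector_derivative
      \<i> * of_real (freq \<epsilon>) * (z t * cis (freq \<epsilon> * t)) - \<i> * of_real (\<epsilon> * ?f / freq \<epsilon>)) (at t within I)"
    using phasor_has_vector_derivative[OF z[OF t], of \<epsilon>] by simp
  then have der: "((\<lambda>t. Re (z t * cis (freq \<epsilon> * t))) has_real_derivative
      - freq \<epsilon> * Im (z t * cis (freq \<epsilon> * t))) (at t within I)"
    "((\<lambda>t. Im (z t * cis (freq \<epsilon> * t))) has_real_derivative
      (freq \<epsilon> * Re (z t * cis (freq \<epsilon> * t)) - \<epsilon> * ?f / freq \<epsilon>)) (at t within I)"
    unfolding has_vector_derivative_complex_iff
    \<comment> \<open>Only products with \<i> on the left are expanded, so \<open>Re\<close> and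
      \<open>Im\<close> of the rotated envelope stay atomic.\<close>
    by (simp_all del: times_complex.sel add: times_complex.sel[of \<i>] times_complex.sel[of "\<i> * _"] flip: of_real_mult)
  show "((\<lambda>t. \<epsilon> * Re (z t * cis (freq \<epsilon> * t))) has_real_derivative
      \<epsilon> * (- freq \<epsilon> * Im (z t * cis (freq \<epsilon> * t)))) (at t within I)"
    by (intro DERIV_cmult der)
  show "((\<lambda>t. \<epsilon> * (- freq \<epsilon> * Im (z t * cis (freq \<epsilon> * t)))) has_real_derivative
      \<epsilon> * (- freq \<epsilon> * (freq \<epsilon> * Re (z t * cis (freq \<epsilon> * t)) - \<epsilon> * ?f / freq \<epsilon>))) (at t within I)"
    by (intro DERIV_cmult der)
  define x y where "x = Re (z t * cis (freq \<epsilon> * t))" "y = Im (z t * cis (freq \<epsilon> * t))"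
  have "\<epsilon> * (- freq \<epsilon> * (freq \<epsilon> * x - \<epsilon> * ?f / freq \<epsilon>)) = \<epsilon>\<^sup>2 * ?f - \<epsilon> * (\<omega>\<^sup>2 + \<epsilon> * detuning \<epsilon>) * x"
    using fp by (simp add: freq_squared[symmetric] field_simps power2_eq_square)
  then show "\<epsilon> * (- freq \<epsilon> * (freq \<epsilon> * Re (z t * cis (freq \<epsilon> * t)) - \<epsilon> * ?f / freq \<epsilon>))
      + \<omega>\<^sup>2 * (\<epsilon> * Re (z t * cis (freq \<epsilon> * t))) + \<epsilon> * lam * (\<epsilon> * (- freq \<epsilon> * Im (z t * cis (freq \<epsilon> * t))))
      + c * (\<epsilon> * Re (z t * cis (freq \<epsilon> * t)))\<^sup>2 + d / \<epsilon> * (\<epsilon> * Re (z t * cis (freq \<epsilon> * t))) ^ 3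
      = \<epsilon>\<^sup>2 * F * cos ((\<omega> + \<epsilon> * \<sigma>) * t)"
    unfolding x_y_def[symmetric] force_def using \<epsilon>0
    by (simp add: freq_def[symmetric] field_simps power2_eq_square power3_eq_cube)
next
  show "\<epsilon> * Re (z 0 * cis (freq \<epsilon> * 0)) = u\<^sub>0"
    using \<epsilon> by (simp add: init small_def)
  show "\<epsilon> * (- freq \<epsilon> * Im (z 0 * cis (freq \<epsilon> * 0))) = v\<^sub>0"
    using \<epsilon> freq_pos[OF \<epsilon>] by (simp add: init small_def)
qed

text \<open>Writing the constant forcing as \<open>F * cnj E * E\<close> lets the phase factor be
  pulled out of the whole field. The real and imaginary parts of what remains are, up to
  \<open>1 / (2 * \<omega>)\<close>, the slow equations solved for \<open>a'\<close> and
  \<open>a * \<beta>'\<close>.\<close>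

lemma slow_field_polar:
  "slow_field (of_real r * cis b) = of_real (1 / (2 * \<omega>)) *
    (of_real (- F * sin b - lam * \<omega> * r)
     + \<i> * of_real (- F * cos b - 2 * \<sigma> * \<omega> * r + 3 * d / 4 * r ^ 3)) * cis b"
proof -
  define E where "E = cis b"
  have E: "E * cnj E = 1" "cnj E = of_real (cos b) - \<i> * of_real (sin b)"
    by (simp_all add: E_def cis_cnj cis_mult) (simp add: complex_eq_iff)
  have F: "complex_of_real F = of_real F * cnj E * E"
    using E(1) by (simp add: mult.assoc mult.commute)
  have "(of_real r * E) * (of_real r * E) * cnj (of_real r * E) = of_real r ^ 3 * E * (E * cnj E)"
    by (simp add: power3_eq_cube mult_ac)
  then have cube: "(of_real r * E) * (of_real r * E) * cnj (of_real r * E) = of_real r ^ 3 * E"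
    unfolding E(1) by simp
  have "slow_field (of_real r * E) = - (\<i> / (2 * of_real \<omega>)) *
    (of_real F * cnj E * E - \<i> * of_real lam * of_real \<omega> * (of_real r * E)
      + 2 * of_real \<sigma> * of_real \<omega> * (of_real r * E) - 3 * of_real d / 4 * (of_real r ^ 3 * E))"
    unfolding slow_field_def cube F[symmetric] ..
  also have "\<dots> = - (\<i> / (2 * of_real \<omega>)) *
    (of_real F * cnj E - \<i> * of_real lam * of_real \<omega> * of_real r
      + 2 * of_real \<sigma> * of_real \<omega> * of_real r - 3 * of_real d / 4 * of_real r ^ 3) * E"
    by (simp add: algebra_simps)
  also have "- (\<i> / (2 * of_real \<omega>)) *
    (of_real F * cnj E - \<i> * of_real lam * of_real \<omega> * of_real r
      + 2 * of_real \<sigma> * of_real \<omega> * of_real r - 3 * of_real d / 4 * of_real r ^ 3)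
    = of_real (1 / (2 * \<omega>)) * (of_real (- F * sin b - lam * \<omega> * r)
     + \<i> * of_real (- F * cos b - 2 * \<sigma> * \<omega> * r + 3 * d / 4 * r ^ 3))"
    using \<omega>_pos unfolding E(2) by (simp add: complex_eq_iff field_simps power3_eq_cube)
  finally show ?thesis
    by (simp only: E_def)
qed

text \<open>The derivative of \<open>a exp (\<i> \<beta>)\<close> is
  \<open>(a' + \<i> a \<beta>') exp (\<i> \<beta>)\<close>. The phase velocity occurs only in the
  product \<open>a * \<beta>'\<close>, just as in the slow system, so negative or vanishing
  \<open>a\<close> is covered too.\<close>

lemma slow_solution_imp_slow_field:
  assumes "slow_solution \<omega> lam d F \<sigma> I a \<beta>" "T \<in> I"
  shows "((\<lambda>T. of_real (a T) * cis (\<beta> T)) has_vector_derivative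
    slow_field (of_real (a T) * cis (\<beta> T))) (at T within I)"
proof -
  obtain a' \<beta>' where a: "(a has_real_derivative a' T) (at T within I)"
    and b: "(\<beta> has_real_derivative \<beta>' T) (at T within I)"
    and a': "2 * \<omega> * a' T + lam * a T * \<omega> = - F * sin (\<beta> T)"
    and b': "2 * a T * \<omega> * \<beta>' T + 2 * \<sigma> * \<omega> * a T - 3 * d * a T ^ 3 / 4 = - F * cos (\<beta> T)"
    using assms unfolding slow_solution_def by blast
  have "((\<lambda>T. of_real (a T)) has_vector_derivative complex_of_real (a' T)) (at T within I)"
    unfolding has_vector_derivative_complex_iff using a by simp
  moreover have "((\<lambda>T. cis (\<beta> T)) has_vector_derivative (of_real (\<beta>' T) * \<i> * cis (\<beta> T))) (at T within I)"
    unfolding has_vector_derivative_def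
    using b by (auto intro!: derivative_eq_intros simp: scaleR_conv_of_real has_field_derivative_def)
  ultimately have "((\<lambda>T. of_real (a T) * cis (\<beta> T)) has_vector_derivative
      (of_real (a T) * (of_real (\<beta>' T) * \<i> * cis (\<beta> T)) + of_real (a' T) * cis (\<beta> T))) (at T within I)"
    by (rule has_vector_derivative_mult)
  also have "of_real (a T) * (of_real (\<beta>' T) * \<i> * cis (\<beta> T)) + of_real (a' T) * cis (\<beta> T)
      = (of_real (a' T) + \<i> * of_real (a T * \<beta>' T)) * cis (\<beta> T)"
    by (simp add: algebra_simps)
  also have "of_real (a' T) + \<i> * of_real (a T * \<beta>' T) = of_real (1 / (2 * \<omega>)) *
    (of_real (- F * sin (\<beta> T) - lam * \<omega> * a T)
     + \<i> * of_real (- F * cos (\<beta> T) - 2 * \<sigma> * \<omega> * a T + 3 * d / 4 * a T ^ 3))"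
    using a' b' \<omega>_pos by (simp add: complex_eq_iff field_simps)
  finally show ?thesis
    unfolding slow_field_polar .
qed

text \<open>
  The condition \<open>near\<close> keeps \<open>Z T / Z 0\<close> in the right half plane, so that the principal logarithm
  lifts \<open>Z\<close> to polar coordinates; \<open>a\<close> keeps the sign of \<open>a\<^sub>0\<close>.
\<close>

lemma slow_field_imp_slow_solution:
  assumes Z: "\<And>T. T \<in> I \<Longrightarrow> (Z has_vector_derivative slow_field (Z T)) (at T within I)"
    and near: "\<And>T. T \<in> I \<Longrightarrow> norm (Z T - Z 0) < norm (Z 0)"
    and init: "Z 0 = of_real a\<^sub>0 * cis \<beta>\<^sub>0"
  obtains a \<beta> where "slow_solution \<omega> lam d F \<sigma> I a \<beta>" "a 0 = a\<^sub>0" "\<beta> 0 = \<beta>\<^sub>0"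
proof (cases "I = {}")
  case True
  then show ?thesis
    by (intro that[of "\<lambda>_. a\<^sub>0" "\<lambda>_. \<beta>\<^sub>0"]) (auto simp: slow_solution_def)
next
  case False
  \<comment> \<open>At any point of the nonempty \<open>I\<close> the strict inequality in
    \<open>near\<close> excludes \<open>Z 0 = 0\<close>.\<close>
  then have Z0: "Z 0 \<noteq> 0"
    using near by fastforce
  then have a0: "a\<^sub>0 \<noteq> 0"
    using init by auto
  define \<Lambda> where "\<Lambda> T = Ln (Z T / Z 0)" for T
  define a where "a T = a\<^sub>0 * exp (Re (\<Lambda> T))" for T
  define \<beta> where "\<beta> T = \<beta>\<^sub>0 + Im (\<Lambda> T)" for T
  \<comment> \<open>The logarithmic derivative of \<open>Z\<close>: its real part is
    \<open>a' / a\<close> and its imaginary part is the phase velocity.\<close>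
  define k where "k T = slow_field (Z T) / Z T" for T
  have "slow_solution \<omega> lam d F \<sigma> I a \<beta>"
    unfolding slow_solution_def
  proof (intro exI ballI)
    fix T assume T: "T \<in> I"
    have "norm (Z T / Z 0 - 1) < 1"
      using near[OF T] Z0 by (simp add: diff_divide_eq_iff norm_divide divide_simps)
    then have "Re (Z T / Z 0) > 0"
      using abs_Re_le_cmod[of "Z T / Z 0 - 1"] by simp
    then have slit: "Z T / Z 0 \<notin> \<real>\<^sub>\<le>\<^sub>0" and ZT: "Z T \<noteq> 0"
      by (auto simp: complex_nonpos_Reals_iff)
    have "((\<lambda>T. Z T / Z 0) has_vector_derivative slow_field (Z T) / Z 0) (at T within I)"
      by (intro has_vector_derivative_divide Z T)
    from field_vector_diff_chain_within[OF this has_field_derivative_Ln[OF slit, THEN has_field_derivative_at_within]]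
    have "(\<Lambda> has_vector_derivative k T) (at T within I)"
      using Z0 ZT by (simp add: o_def \<Lambda>_def[abs_def] k_def field_simps)
    then have der: "((\<lambda>T. Re (\<Lambda> T)) has_real_derivative Re (k T)) (at T within I)"
      "((\<lambda>T. Im (\<Lambda> T)) has_real_derivative Im (k T)) (at T within I)"
      by (auto simp: has_vector_derivative_complex_iff)
    have aT: "a T \<noteq> 0"
      using a0 by (simp add: a_def)
    have "exp (\<Lambda> T) = Z T / Z 0"
      unfolding \<Lambda>_def using ZT Z0 by simp
    then have "Z T = Z 0 * exp (\<Lambda> T)"
      using Z0 by simp
    also have "\<dots> = of_real (a T) * cis (\<beta> T)"
      unfolding exp_eq_polar[of "\<Lambda> T"] init a_def \<beta>_def cis_mult[symmetric] of_real_mult by (simp only: mult_ac)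
    finally have polar: "Z T = of_real (a T) * cis (\<beta> T)" .
    have k_eq: "of_real (2 * \<omega> * a T) * k T = of_real (- F * sin (\<beta> T) - lam * \<omega> * a T)
        + \<i> * of_real (- F * cos (\<beta> T) - 2 * \<sigma> * \<omega> * a T + 3 * d / 4 * a T ^ 3)"
      using aT \<omega>_pos unfolding k_def polar slow_field_polar by simp
    have k: "2 * \<omega> * a T * Re (k T) = - F * sin (\<beta> T) - lam * \<omega> * a T"
      "2 * \<omega> * a T * Im (k T) = - F * cos (\<beta> T) - 2 * \<sigma> * \<omega> * a T + 3 * d / 4 * a T ^ 3"
      using arg_cong[OF k_eq, of Re] arg_cong[OF k_eq, of Im]
      by (simp_all only: Re_complex_of_real Im_complex_of_real times_complex.sel plus_complex.sel
          imaginary_unit.sel) simp_all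
    show "(a has_real_derivative a T * Re (k T)) (at T within I) \<and>
       (\<beta> has_real_derivative Im (k T)) (at T within I) \<and>
       2 * \<omega> * (a T * Re (k T)) + lam * a T * \<omega> = - F * sin (\<beta> T) \<and>
       2 * a T * \<omega> * Im (k T) + 2 * \<sigma> * \<omega> * a T - 3 * d * a T ^ 3 / 4 = - F * cos (\<beta> T)"
    proof (intro conjI)
      show "(a has_real_derivative a T * Re (k T)) (at T within I)"
        unfolding a_def[abs_def] by (rule derivative_eq_intros der refl)+ simp
      show "(\<beta> has_real_derivative Im (k T)) (at T within I)"
        unfolding \<beta>_def[abs_def] by (rule derivative_eq_intros der refl)+ simp
    qed (use k in \<open>simp_all add: algebra_simps\<close>)
  qed
  moreover have "a 0 = a\<^sub>0" "\<beta> 0 = \<beta>\<^sub>0"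
    using Z0 by (auto simp: a_def \<beta>_def \<Lambda>_def)
  ultimately show ?thesis
    by (rule that)
qed

subsection \<open>Existence and the remainder\<close>

text \<open>Because of the conjugate the field is only real differentiable: the derivative at
  \<open>z\<close> in direction \<open>w\<close> is real linear in \<open>w\<close>, but in general
  no multiplication by a complex number. It enters the second derivative of the remainder.\<close>

definition slow_field_derivative :: "complex \<Rightarrow> complex \<Rightarrow> complex"
  where "slow_field_derivative z w = - (\<i> / (2 * of_real \<omega>)) *
    (2 * of_real \<sigma> * of_real \<omega> * w - \<i> * of_real lam * of_real \<omega> * w
      - 3 * of_real d / 4 * (z * z * cnj w + (z * w + w * z) * cnj z))"

lemma slow_field_has_vector_derivative:
  assumes "(z has_vector_derivative z') (at t within S)"
  shows "((\<lambda>t. slow_field (z t)) has_vector_derivative slow_field_derivative (z t) z') (at t within S)"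
proof -
  have "((\<lambda>t. - (\<i> / (2 * of_real \<omega>)) * (of_real F - \<i> * of_real lam * of_real \<omega> * z t
        + 2 * of_real \<sigma> * of_real \<omega> * z t - 3 * of_real d / 4 * (z t * z t * cnj (z t)))) has_vector_derivative
      - (\<i> / (2 * of_real \<omega>)) * (0 - \<i> * of_real lam * of_real \<omega> * z'
        + 2 * of_real \<sigma> * of_real \<omega> * z' - 3 * of_real d / 4 * (z t * z t * cnj z' + (z t * z' + z' * z t) * cnj (z t))))
      (at t within S)"
    by (intro has_vector_derivative_mult_right has_vector_derivative_diff has_vector_derivative_add
        has_vector_derivative_const has_vector_derivative_mult has_vector_derivative_cnj assms)
  then show ?thesis
    unfolding slow_field_def slow_field_derivative_def by simp
qed

lemma slow_field_derivative_bounded: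
  obtains C where "0 \<le> C"
    and "\<And>z w. norm z \<le> R \<Longrightarrow> norm w \<le> M \<Longrightarrow> norm (slow_field_derivative z w) \<le> C"
proof
  let ?C = "norm (- (\<i> / (2 * of_real \<omega>))) *
    (\<bar>2 * \<sigma> * \<omega>\<bar> * \<bar>M\<bar> + \<bar>lam * \<omega>\<bar> * \<bar>M\<bar> + \<bar>3 * d / 4\<bar> * (3 * (\<bar>R\<bar> * \<bar>R\<bar> * \<bar>M\<bar>)))"
  show "0 \<le> ?C"
    by (intro mult_nonneg_nonneg add_nonneg_nonneg) auto
  show "norm (slow_field_derivative z w) \<le> ?C" if "norm z \<le> R" "norm w \<le> M" for z w
  proof -
    define X Y where "X = \<bar>R\<bar>" and "Y = \<bar>M\<bar>"
    have XY: "norm z \<le> X" "norm w \<le> Y" "0 \<le> X" "0 \<le> Y"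
      using that by (auto simp: X_def Y_def)
    let ?A = "2 * of_real \<sigma> * of_real \<omega> * w" and ?B = "\<i> * of_real lam * of_real \<omega> * w"
    let ?p = "z * z * cnj w" and ?q = "z * w * cnj z" and ?r = "w * z * cnj z"
    have lin: "norm ?A \<le> \<bar>2 * \<sigma> * \<omega>\<bar> * Y" "norm ?B \<le> \<bar>lam * \<omega>\<bar> * Y"
      using mult_left_mono[OF XY(2), of "\<bar>2 * \<sigma> * \<omega>\<bar>"] mult_left_mono[OF XY(2), of "\<bar>lam * \<omega>\<bar>"]
      by (simp_all add: norm_mult abs_mult mult.assoc)
    have cub: "norm ?p \<le> X * X * Y" "norm ?q \<le> X * Y * X" "norm ?r \<le> Y * X * X"
      unfolding norm_mult complex_mod_cnj using XY by (auto intro!: mult_mono)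
    have "norm (?p + (z * w + w * z) * cnj z) \<le> 3 * (X * X * Y)"
      using cub norm_triangle_ineq[of ?p "?q + ?r"] norm_triangle_ineq[of ?q ?r]
      by (simp add: algebra_simps)
    then have "norm (3 * of_real d / 4 * (?p + (z * w + w * z) * cnj z)) \<le> \<bar>3 * d / 4\<bar> * (3 * (X * X * Y))"
      unfolding norm_mult[of "3 * of_real d / 4"] by (intro mult_mono) (auto simp: norm_mult norm_divide)
    then have "norm (?A - ?B - 3 * of_real d / 4 * (?p + (z * w + w * z) * cnj z))
        \<le> \<bar>2 * \<sigma> * \<omega>\<bar> * Y + \<bar>lam * \<omega>\<bar> * Y + \<bar>3 * d / 4\<bar> * (3 * (X * X * Y))" (is "norm (_ - _ - ?D) \<le> _")
      using lin norm_triangle_ineq4[of "?A - ?B" ?D] norm_triangle_ineq4[of ?A ?B] by linarith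
    then show ?thesis
      unfolding slow_field_derivative_def norm_mult[of "- (\<i> / (2 * of_real \<omega>))"] X_def Y_def
      by (rule mult_left_mono) simp
  qed
qed

text \<open>The field has size \<open>\<epsilon> * M\<close> and the interval has length
  \<open>\<gamma> / \<epsilon>\<close>, so \<epsilon> cancels and both Picard conditions reduce to
  smallness of \<open>M * \<gamma>\<close>.\<close>

lemma fast_field_exists:
  assumes \<epsilon>: "small \<epsilon>" and "0 \<le> \<gamma>" "0 \<le> \<rho>" "norm z\<^sub>0 + \<rho> \<le> R" "0 \<le> M" "M * \<gamma> \<le> \<rho>" "M * \<gamma> < 1"
    and bnd: "\<And>t z. norm z \<le> R \<Longrightarrow> norm (fast_field \<epsilon> t z) \<le> M"
    and lip: "\<And>t z y. norm z \<le> R \<Longrightarrow> norm y \<le> R \<Longrightarrow>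
      norm (fast_field \<epsilon> t z - fast_field \<epsilon> t y) \<le> M * norm (z - y)"
  obtains z where "z 0 = z\<^sub>0" and "\<And>t. t \<in> {0..\<gamma> / \<epsilon>} \<Longrightarrow>
    (z has_vector_derivative of_real \<epsilon> * fast_field \<epsilon> t (z t)) (at t within {0..\<gamma> / \<epsilon>})"
proof -
  have \<epsilon>0: "0 < \<epsilon>"
    using \<epsilon> by (simp add: small_def)
  have R: "norm z \<le> R" if "z \<in> cball z\<^sub>0 \<rho>" for z
    using that assms(4) norm_triangle_ineq2[of z z\<^sub>0] by (auto simp: dist_norm norm_minus_commute)
  show thesis
  proof (rule picard_local_existence[where f = "\<lambda>t z. of_real \<epsilon> * fast_field \<epsilon> t z" and x\<^sub>0 = z\<^sub>0
        and \<rho> = \<rho> and \<tau> = "\<gamma> / \<epsilon>" and B = "\<epsilon> * M" and L = "\<epsilon> * M"])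
    show "continuous_on ({0..\<gamma> / \<epsilon>} \<times> cball z\<^sub>0 \<rho>) (\<lambda>(t, z). of_real \<epsilon> * fast_field \<epsilon> t z)"
      unfolding fast_field_def force_def case_prod_beta by (intro continuous_intros)
    show "norm (of_real \<epsilon> * fast_field \<epsilon> t z) \<le> \<epsilon> * M" if "z \<in> cball z\<^sub>0 \<rho>" for t z
      using bnd[OF R[OF that]] \<epsilon>0 by (simp add: norm_mult)
    show "norm (of_real \<epsilon> * fast_field \<epsilon> t z - of_real \<epsilon> * fast_field \<epsilon> t y) \<le> \<epsilon> * M * norm (z - y)"
      if "z \<in> cball z\<^sub>0 \<rho>" "y \<in> cball z\<^sub>0 \<rho>" for t z y
      using lip[OF R[OF that(1)] R[OF that(2)]] \<epsilon>0
      by (simp add: norm_mult right_diff_distrib[symmetric] mult.assoc)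
  qed (use assms \<epsilon>0 that in auto)
qed

lemma continuous_on_slow_field: "continuous_on S slow_field"
  unfolding slow_field_def[abs_def] by (intro continuous_intros)

lemma slow_field_exists:
  assumes "0 \<le> \<gamma>" "0 \<le> \<rho>" "norm z\<^sub>0 + \<rho> \<le> R" "0 \<le> M" "M * \<gamma> \<le> \<rho>" "M * \<gamma> < 1"
    and bnd: "\<And>z. norm z \<le> R \<Longrightarrow> norm (slow_field z) \<le> M"
    and lip: "\<And>z y. norm z \<le> R \<Longrightarrow> norm y \<le> R \<Longrightarrow>
      norm (slow_field z - slow_field y) \<le> M * norm (z - y)"
  obtains Z where "Z 0 = z\<^sub>0" and "\<And>T. T \<in> {0..\<gamma>} \<Longrightarrow> norm (Z T - z\<^sub>0) \<le> \<rho>"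
    and "\<And>T. T \<in> {0..\<gamma>} \<Longrightarrow> (Z has_vector_derivative slow_field (Z T)) (at T within {0..\<gamma>})"
proof -
  have R: "norm z \<le> R" if "z \<in> cball z\<^sub>0 \<rho>" for z
    using that assms(3) norm_triangle_ineq2[of z z\<^sub>0] by (auto simp: dist_norm norm_minus_commute)
  show thesis
  proof (rule picard_local_existence[where f = "\<lambda>_. slow_field" and x\<^sub>0 = z\<^sub>0
        and \<rho> = \<rho> and \<tau> = \<gamma> and B = M and L = M])
    show "continuous_on ({0..\<gamma>} \<times> cball z\<^sub>0 \<rho>) (\<lambda>(t, z). slow_field z)"
      unfolding case_prod_unfold
      by (rule continuous_on_compose2[OF continuous_on_slow_field continuous_on_snd[OF continuous_on_id] subset_UNIV])
    show "norm (slow_field z) \<le> M" if "z \<in> cball z\<^sub>0 \<rho>" for z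
      by (rule bnd[OF R[OF that]])
    show "norm (slow_field z - slow_field y) \<le> M * norm (z - y)"
      if "z \<in> cball z\<^sub>0 \<rho>" "y \<in> cball z\<^sub>0 \<rho>" for z y
      by (rule lip[OF R[OF that(1)] R[OF that(2)]])
    note Z_that = that
    show thesis if "Z 0 = z\<^sub>0" "\<And>T. T \<in> {0..\<gamma>} \<Longrightarrow> Z T \<in> cball z\<^sub>0 \<rho>"
      "\<And>T. T \<in> {0..\<gamma>} \<Longrightarrow> (Z has_vector_derivative slow_field (Z T)) (at T within {0..\<gamma>})" for Z
      using that by (intro Z_that[of Z]) (auto simp: dist_norm norm_minus_commute)
  qed (use assms in auto)
qed

text \<open>
  Because \<open>fast_field * cis (\<Omega> t)\<close> is purely imaginary, the fast field drops out of the first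
  derivative and never has to be differentiated itself.
\<close>

lemma remainder_C2_bounded:
  assumes \<epsilon>: "small \<epsilon>" and "0 \<le> K"
    and z: "\<And>t. t \<in> I \<Longrightarrow> (z has_vector_derivative of_real \<epsilon> * fast_field \<epsilon> t (z t)) (at t within I)"
    and W: "\<And>t. t \<in> I \<Longrightarrow> (W has_vector_derivative of_real \<epsilon> * slow_field (W t)) (at t within I)"
    and close: "\<And>t. t \<in> I \<Longrightarrow> norm (z t - W t) \<le> \<epsilon> * K"
    and fast: "\<And>t. t \<in> I \<Longrightarrow> norm (fast_field \<epsilon> t (z t)) \<le> M"
    and slow: "\<And>t. t \<in> I \<Longrightarrow> norm (slow_field (W t)) \<le> M"
    and slow': "\<And>t. t \<in> I \<Longrightarrow> norm (slow_field_derivative (W t) (of_real \<epsilon> * slow_field (W t))) \<le> C"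
  shows "C2_bounded_on I ((2 * \<omega> * M + 2 * \<omega> * M + C) + (K + 2 * \<omega> * (2 * \<omega> * K + M) + (2 * \<omega> * K + M)))
    (\<lambda>t. Re ((z t - W t) / of_real \<epsilon> * cis (freq \<epsilon> * t)))"
proof -
  let ?\<Omega> = "freq \<epsilon>"
  have \<epsilon>0: "0 < \<epsilon>"
    using \<epsilon> by (simp add: small_def)
  have fp: "0 < ?\<Omega>" "?\<Omega> \<le> 2 * \<omega>"
    using freq_pos[OF \<epsilon>] freq_bounds[OF \<epsilon>] by auto
  \<comment> \<open>Rotated by \<open>cis (\<Omega> t)\<close>, the real parts of \<open>y0\<close>,
    \<open>y1\<close>, \<open>y2\<close> are the remainder and its first two derivatives. The
    division by \<epsilon> does no harm in the derivative of \<open>y0\<close>, since those of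
    \<open>z\<close> and \<open>W\<close> both carry this factor.\<close>
  define y0 where "y0 t = (z t - W t) / of_real \<epsilon>" for t
  define y1 where "y1 t = \<i> * of_real ?\<Omega> * y0 t - slow_field (W t)" for t
  define y2 where "y2 t = \<i> * of_real ?\<Omega> * (fast_field \<epsilon> t (z t) - slow_field (W t))
    - slow_field_derivative (W t) (of_real \<epsilon> * slow_field (W t)) + \<i> * of_real ?\<Omega> * y1 t" for t
  have y0: "(y0 has_vector_derivative (fast_field \<epsilon> t (z t) - slow_field (W t))) (at t within I)"
    if "t \<in> I" for t
  proof -
    have "(y0 has_vector_derivative ((of_real \<epsilon> * fast_field \<epsilon> t (z t) - of_real \<epsilon> * slow_field (W t)) / of_real \<epsilon>))
      (at t within I)"
      unfolding y0_def[abs_def]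
      by (intro has_vector_derivative_divide has_vector_derivative_diff z W that)
    then show ?thesis
      using \<epsilon>0 by (simp add: diff_divide_distrib)
  qed
  have y1: "(y1 has_vector_derivative (\<i> * of_real ?\<Omega> * (fast_field \<epsilon> t (z t) - slow_field (W t))
    - slow_field_derivative (W t) (of_real \<epsilon> * slow_field (W t)))) (at t within I)" if "t \<in> I" for t
    unfolding y1_def[abs_def]
    by (intro has_vector_derivative_mult_right has_vector_derivative_diff y0
        slow_field_has_vector_derivative W that)
  have fast_Re: "Re (fast_field \<epsilon> t (z t) * cis (?\<Omega> * t)) = 0" for t
  proof -
    have "fast_field \<epsilon> t (z t) * cis (?\<Omega> * t) = - (\<i> / of_real ?\<Omega>) *
        (of_real (force \<epsilon> t (z t * cis (?\<Omega> * t))) * (cis (- (?\<Omega> * t)) * cis (?\<Omega> * t)))"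
      unfolding fast_field_def by (simp only: mult.assoc)
    then show ?thesis
      by (simp add: cis_mult)
  qed
  have der0: "((\<lambda>t. Re (y0 t * cis (?\<Omega> * t))) has_real_derivative Re (y1 t * cis (?\<Omega> * t))) (at t within I)"
    if "t \<in> I" for t
  proof -
    have "((\<lambda>t. Re (y0 t * cis (?\<Omega> * t))) has_real_derivative
      Re ((fast_field \<epsilon> t (z t) - slow_field (W t) + \<i> * of_real ?\<Omega> * y0 t) * cis (?\<Omega> * t))) (at t within I)"
      using phasor_has_vector_derivative[OF y0[OF that], of \<epsilon>]
      unfolding has_vector_derivative_complex_iff by blast
    moreover have "(fast_field \<epsilon> t (z t) - slow_field (W t) + \<i> * of_real ?\<Omega> * y0 t) * cis (?\<Omega> * t)
      = fast_field \<epsilon> t (z t) * cis (?\<Omega> * t) + y1 t * cis (?\<Omega> * t)"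
      by (simp add: y1_def algebra_simps)
    ultimately show ?thesis
      by (simp only: plus_complex.sel fast_Re add_0_left)
  qed
  have der1: "((\<lambda>t. Re (y1 t * cis (?\<Omega> * t))) has_real_derivative Re (y2 t * cis (?\<Omega> * t))) (at t within I)"
    if "t \<in> I" for t
    using phasor_has_vector_derivative[OF y1[OF that], of \<epsilon>]
    unfolding has_vector_derivative_complex_iff y2_def by blast
  have cont: "continuous_on I (\<lambda>t. Re (y2 t * cis (?\<Omega> * t)))"
  proof -
    have "continuous_on I z" "continuous_on I W"
      using has_vector_derivative_continuous[OF z] has_vector_derivative_continuous[OF W]
      by (auto simp: continuous_on_eq_continuous_within)
    then show ?thesis
      using \<epsilon>0 fp \<omega>_pos
      unfolding y2_def y1_def y0_def slow_field_def slow_field_derivative_def fast_field_def force_def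
      by (intro continuous_intros) auto
  qed
  \<comment> \<open>The signs of \<open>M\<close> and \<open>C\<close> are read off from norms at a
    point, so they are established for \<open>t\<close> in \<open>I\<close> together with the
    bounds.\<close>
  have bounds: "\<bar>Re (y0 t * cis (?\<Omega> * t))\<bar> \<le> K" "\<bar>Re (y1 t * cis (?\<Omega> * t))\<bar> \<le> 2 * \<omega> * K + M"
    "\<bar>Re (y2 t * cis (?\<Omega> * t))\<bar> \<le> (2 * \<omega> * M + 2 * \<omega> * M + C) + 2 * \<omega> * (2 * \<omega> * K + M)"
    "0 \<le> M" "0 \<le> C" if t: "t \<in> I" for t
  proof -
    have Re_le: "\<bar>Re (w * cis (?\<Omega> * t))\<bar> \<le> norm w" for w
      using abs_Re_le_cmod[of "w * cis (?\<Omega> * t)"] by (simp add: norm_mult)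
    have freq_mult: "norm (\<i> * of_real ?\<Omega> * w) \<le> 2 * \<omega> * B" if "norm w \<le> B" for w B
      using that fp order_trans[OF norm_ge_zero that] by (simp add: norm_mult mult_mono)
    have n0: "norm (y0 t) \<le> K"
      using close[OF t] \<epsilon>0 by (simp add: y0_def norm_divide divide_le_eq mult.commute)
    have n1: "norm (y1 t) \<le> 2 * \<omega> * K + M"
      unfolding y1_def
      by (rule order_trans[OF norm_triangle_ineq4 add_mono[OF freq_mult[OF n0] slow[OF t]]])
    have acc: "norm (\<i> * of_real ?\<Omega> * (fast_field \<epsilon> t (z t) - slow_field (W t))) \<le> 2 * \<omega> * (M + M)"
      by (intro freq_mult order_trans[OF norm_triangle_ineq4 add_mono[OF fast[OF t] slow[OF t]]])
    have "norm (y2 t) \<le> (2 * \<omega> * (M + M) + C) + 2 * \<omega> * (2 * \<omega> * K + M)"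
      unfolding y2_def
      by (rule order_trans[OF norm_triangle_ineq add_mono[OF
            order_trans[OF norm_triangle_ineq4 add_mono[OF acc slow'[OF t]]] freq_mult[OF n1]]])
    then have n2: "norm (y2 t) \<le> (2 * \<omega> * M + 2 * \<omega> * M + C) + 2 * \<omega> * (2 * \<omega> * K + M)"
      by (simp add: distrib_left)
    show "\<bar>Re (y0 t * cis (?\<Omega> * t))\<bar> \<le> K" "\<bar>Re (y1 t * cis (?\<Omega> * t))\<bar> \<le> 2 * \<omega> * K + M"
      "\<bar>Re (y2 t * cis (?\<Omega> * t))\<bar> \<le> (2 * \<omega> * M + 2 * \<omega> * M + C) + 2 * \<omega> * (2 * \<omega> * K + M)"
      by (rule order_trans[OF Re_le n0] order_trans[OF Re_le n1] order_trans[OF Re_le n2])+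
    show "0 \<le> M" "0 \<le> C"
      using order_trans[OF norm_ge_zero slow[OF t]] order_trans[OF norm_ge_zero slow'[OF t]] .
  qed
  have le: "x \<le> (2 * \<omega> * M + 2 * \<omega> * M + C) + (K + 2 * \<omega> * (2 * \<omega> * K + M) + (2 * \<omega> * K + M))"
    if "x \<le> K \<or> x \<le> 2 * \<omega> * K + M \<or> x \<le> (2 * \<omega> * M + 2 * \<omega> * M + C) + 2 * \<omega> * (2 * \<omega> * K + M)"
      "0 \<le> M" "0 \<le> C" for x
  proof -
    have "0 \<le> 2 * \<omega> * M" "0 \<le> 2 * \<omega> * K" "0 \<le> 2 * \<omega> * (2 * \<omega> * K + M)"
      using that(2) \<open>0 \<le> K\<close> \<omega>_pos by auto
    with that \<open>0 \<le> K\<close> show ?thesis by linarith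
  qed
  show ?thesis
    unfolding C2_bounded_on_def y0_def[symmetric]
  proof (intro exI conjI ballI)
    show "continuous_on I (\<lambda>t. Re (y2 t * cis (?\<Omega> * t)))"
      by (rule cont)
    fix t assume t: "t \<in> I"
    note b = bounds[OF t]
    show "((\<lambda>t. Re (y0 t * cis (?\<Omega> * t))) has_real_derivative Re (y1 t * cis (?\<Omega> * t))) (at t within I)"
      "((\<lambda>t. Re (y1 t * cis (?\<Omega> * t))) has_real_derivative Re (y2 t * cis (?\<Omega> * t))) (at t within I)"
      by (rule der0[OF t] der1[OF t])+
    show "\<bar>Re (y0 t * cis (?\<Omega> * t))\<bar> \<le> (2 * \<omega> * M + 2 * \<omega> * M + C) + (K + 2 * \<omega> * (2 * \<omega> * K + M) + (2 * \<omega> * K + M))"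
      by (rule le[OF disjI1[OF b(1)] b(4,5)])
    show "\<bar>Re (y1 t * cis (?\<Omega> * t))\<bar> \<le> (2 * \<omega> * M + 2 * \<omega> * M + C) + (K + 2 * \<omega> * (2 * \<omega> * K + M) + (2 * \<omega> * K + M))"
      by (rule le[OF disjI2[OF disjI1[OF b(2)]] b(4,5)])
    show "\<bar>Re (y2 t * cis (?\<Omega> * t))\<bar> \<le> (2 * \<omega> * M + 2 * \<omega> * M + C) + (K + 2 * \<omega> * (2 * \<omega> * K + M) + (2 * \<omega> * K + M))"
      by (rule le[OF disjI2[OF disjI2[OF b(3)]] b(4,5)])
  qed
qed

section \<open>Matching the initial data and assembling the result\<close>

lemma initial_envelope_close:
  assumes \<epsilon>: "small \<epsilon>" and "0 \<le> k\<^sub>1" "0 \<le> k\<^sub>2" "\<bar>a\<bar> \<le> A"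
    and u: "\<bar>u - \<epsilon> * a * cos b\<bar> \<le> k\<^sub>1 * \<epsilon>\<^sup>2"
    and v: "\<bar>v + \<epsilon> * \<omega> * a * sin b\<bar> \<le> k\<^sub>2 * \<epsilon>\<^sup>2"
  shows "norm (Complex (u / \<epsilon>) (- v / (\<epsilon> * freq \<epsilon>)) - of_real a * cis b)
    \<le> \<epsilon> * (k\<^sub>1 + 2 / \<omega> * (k\<^sub>2 + \<bar>\<sigma>\<bar> * A))"
proof -
  have \<epsilon>0: "0 < \<epsilon>"
    using \<epsilon> by (simp add: small_def)
  have fp: "0 < freq \<epsilon>"
    by (rule freq_pos[OF \<epsilon>])
  let ?w = "Complex (u / \<epsilon>) (- v / (\<epsilon> * freq \<epsilon>)) - of_real a * cis b"
  have "Re ?w = (u - \<epsilon> * a * cos b) / \<epsilon>"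
    using \<epsilon>0 by (simp add: field_simps)
  then have "\<bar>Re ?w\<bar> = \<bar>u - \<epsilon> * a * cos b\<bar> / \<epsilon>"
    using \<epsilon>0 by simp
  also have "\<dots> \<le> k\<^sub>1 * \<epsilon>\<^sup>2 / \<epsilon>"
    using u \<epsilon>0 by (simp add: divide_right_mono)
  finally have Re: "\<bar>Re ?w\<bar> \<le> \<epsilon> * k\<^sub>1"
    using \<epsilon>0 by (simp add: power2_eq_square mult.commute)
  \<comment> \<open>The data carry the velocity factor \<omega>, the envelope uses
    \<open>freq \<epsilon>\<close>. The mismatch \<open>\<epsilon> * \<sigma> * (a * sin b)\<close>
    is again O(\<epsilon>) and yields the summand \<open>\<bar>\<sigma>\<bar> * A\<close>.\<close>
  have "(v + \<epsilon> * \<omega> * a * sin b) / \<epsilon> + \<epsilon> * \<sigma> * (a * sin b) = v / \<epsilon> + freq \<epsilon> * (a * sin b)"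
    using \<epsilon>0 by (simp add: freq_def field_simps)
  moreover have "Im ?w = - (v / \<epsilon> + freq \<epsilon> * (a * sin b)) / freq \<epsilon>"
    using \<epsilon>0 fp by (simp add: field_simps)
  ultimately have "Im ?w = - ((v + \<epsilon> * \<omega> * a * sin b) / \<epsilon> + \<epsilon> * \<sigma> * (a * sin b)) / freq \<epsilon>"
    by (simp only:)
  then have "\<bar>Im ?w\<bar> = \<bar>(v + \<epsilon> * \<omega> * a * sin b) / \<epsilon> + \<epsilon> * \<sigma> * (a * sin b)\<bar> / freq \<epsilon>"
    using fp by (simp only: abs_divide abs_minus_cancel abs_of_pos)
  also have "\<dots> \<le> 2 / \<omega> * \<bar>(v + \<epsilon> * \<omega> * a * sin b) / \<epsilon> + \<epsilon> * \<sigma> * (a * sin b)\<bar>"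
    by (rule inverse_freq_bound[OF \<epsilon>]) simp
  also have "\<dots> \<le> 2 / \<omega> * (\<epsilon> * (k\<^sub>2 + \<bar>\<sigma>\<bar> * A))"
  proof (rule mult_left_mono)
    have "\<bar>(v + \<epsilon> * \<omega> * a * sin b) / \<epsilon>\<bar> \<le> k\<^sub>2 * \<epsilon>\<^sup>2 / \<epsilon>"
      using v \<epsilon>0 by (simp add: divide_right_mono)
    then have "\<bar>(v + \<epsilon> * \<omega> * a * sin b) / \<epsilon>\<bar> \<le> \<epsilon> * k\<^sub>2"
      using \<epsilon>0 by (simp add: power2_eq_square mult.commute)
    moreover have "\<bar>a * sin b\<bar> \<le> A * 1"
      unfolding abs_mult using assms(4) by (intro mult_mono) auto
    then have "\<bar>\<epsilon> * \<sigma> * (a * sin b)\<bar> \<le> \<epsilon> * (\<bar>\<sigma>\<bar> * A)"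
      using \<epsilon>0 unfolding abs_mult[of "\<epsilon> * \<sigma>"] abs_mult[of \<epsilon> \<sigma>] by (simp add: mult.assoc mult_left_mono)
    ultimately show "\<bar>(v + \<epsilon> * \<omega> * a * sin b) / \<epsilon> + \<epsilon> * \<sigma> * (a * sin b)\<bar> \<le> \<epsilon> * (k\<^sub>2 + \<bar>\<sigma>\<bar> * A)"
      unfolding distrib_left by (rule order_trans[OF abs_triangle_ineq add_mono])
  qed (use \<omega>_pos in simp)
  finally have Im: "\<bar>Im ?w\<bar> \<le> \<epsilon> * (2 / \<omega> * (k\<^sub>2 + \<bar>\<sigma>\<bar> * A))"
    by (simp only: mult.left_commute)
  show ?thesis
    unfolding distrib_left[of \<epsilon> k\<^sub>1] by (rule order_trans[OF cmod_le add_mono[OF Re Im]])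
qed

text \<open>Existence comes from contraction and ensures that the expansion is not vacuous; the
  expansion itself is proved for every pair of solutions, through confinement and averaging.
  \<gamma> and \<open>K\<close> are fixed before \<epsilon>, which expresses uniform boundedness of
  the remainder.\<close>

theorem slow_modulation:
  assumes "abar \<noteq> 0"
    and compat: "compatible_initial_data \<omega> a\<^sub>0 \<beta>\<^sub>0 u\<^sub>0 v\<^sub>0"
    and a0_near: "\<forall>\<^sub>F \<epsilon> in at_right 0. \<bar>a\<^sub>0 \<epsilon> - abar\<bar> \<le> \<epsilon> * C\<^sub>1"
  shows "\<exists>\<gamma>>0. \<exists>K. \<forall>\<^sub>F \<epsilon> in at_right 0.
    (\<exists>u. oscillator_solution \<omega> lam c d F \<sigma> \<epsilon> {0..\<gamma> / \<epsilon>} (u\<^sub>0 \<epsilon>) (v\<^sub>0 \<epsilon>) u) \<and>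
    (\<exists>a \<beta>. slow_solution \<omega> lam d F \<sigma> {0..\<gamma>} a \<beta> \<and> a 0 = a\<^sub>0 \<epsilon> \<and> \<beta> 0 = \<beta>\<^sub>0 \<epsilon>) \<and>
    (\<forall>u a \<beta>.
       oscillator_solution \<omega> lam c d F \<sigma> \<epsilon> {0..\<gamma> / \<epsilon>} (u\<^sub>0 \<epsilon>) (v\<^sub>0 \<epsilon>) u \<longrightarrow>
       slow_solution \<omega> lam d F \<sigma> {0..\<gamma>} a \<beta> \<and> a 0 = a\<^sub>0 \<epsilon> \<and> \<beta> 0 = \<beta>\<^sub>0 \<epsilon> \<longrightarrow>
       (\<exists>r. (\<forall>t\<in>{0..\<gamma> / \<epsilon>}.
               u t = \<epsilon> * a (\<epsilon> * t) * cos ((\<omega> + \<epsilon> * \<sigma>) * t + \<beta> (\<epsilon> * t)) + \<epsilon>\<^sup>2 * r t) \<and>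
            C2_bounded_on {0<..<\<gamma> / \<epsilon>} K r))"
proof -
  define A where "A = \<bar>abar\<bar>"
  have A: "0 < A"
    using assms(1) by (simp add: A_def)
  \<comment> \<open>For small \<epsilon> the slow amplitude starts at most at
    \<open>3 / 2 * A\<close> and the envelope at most at \<open>2 * A\<close>; a displacement by
    \<open>A / 4\<close> leaves both within \<open>3 * A\<close>.\<close>
  define R where "R = 3 * A"
  obtain M\<^sub>1 where M1: "0 \<le> M\<^sub>1" "\<And>\<epsilon> t z. small \<epsilon> \<Longrightarrow> norm z \<le> R \<Longrightarrow> norm (fast_field \<epsilon> t z) \<le> M\<^sub>1"
    "\<And>\<epsilon> t z y. small \<epsilon> \<Longrightarrow> norm z \<le> R \<Longrightarrow> norm y \<le> R \<Longrightarrow>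
      norm (fast_field \<epsilon> t z - fast_field \<epsilon> t y) \<le> M\<^sub>1 * norm (z - y)"
    by (rule fast_field_bounds[of R]) (rule that; blast)
  obtain M\<^sub>2 where M2: "0 \<le> M\<^sub>2" "\<And>z. norm z \<le> R \<Longrightarrow> norm (slow_field z) \<le> M\<^sub>2"
    "\<And>z y. norm z \<le> R \<Longrightarrow> norm y \<le> R \<Longrightarrow> norm (slow_field z - slow_field y) \<le> M\<^sub>2 * norm (z - y)"
    by (rule slow_field_bounds[of R]) (rule that; blast)
  obtain C where C: "0 \<le> C" "\<And>z w. norm z \<le> R \<Longrightarrow> norm w \<le> M\<^sub>2 \<Longrightarrow> norm (slow_field_derivative z w) \<le> C"
    by (rule slow_field_derivative_bounded[of R M\<^sub>2]) (rule that; blast)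
  define M where "M = M\<^sub>1 + M\<^sub>2"
  have M: "0 \<le> M" "M\<^sub>1 \<le> M" "M\<^sub>2 \<le> M"
    using M1(1) M2(1) by (auto simp: M_def)
  \<comment> \<open>\<open>M * \<gamma> \<le> A / 8\<close> lies strictly below the ball radius
    \<open>A / 4\<close>, as confinement demands; \<open>M * \<gamma> \<le> 1 / 2\<close> serves
    contraction and absorption. The summand in \<open>M + 1\<close> prevents division by
    zero.\<close>
  define \<gamma> where "\<gamma> = min (A / 8) (1 / 2) / (M + 1)"
  have \<gamma>: "0 < \<gamma>"
    using A M(1) by (simp add: \<gamma>_def)
  have "M * \<gamma> \<le> min (A / 8) (1 / 2)"
  proof -
    have "M * \<gamma> = min (A / 8) (1 / 2) * (M / (M + 1))"
      by (simp add: \<gamma>_def)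
    also have "\<dots> \<le> min (A / 8) (1 / 2) * 1"
      using A M(1) by (intro mult_left_mono) (auto simp: divide_le_eq)
    finally show ?thesis by simp
  qed
  then have M\<gamma>: "M * \<gamma> \<le> A / 8" "M * \<gamma> \<le> 1 / 2"
    by auto
  have M1\<gamma>: "M\<^sub>1 * \<gamma> \<le> A / 8" "M\<^sub>1 * \<gamma> \<le> 1 / 2" and M2\<gamma>: "M\<^sub>2 * \<gamma> \<le> A / 8" "M\<^sub>2 * \<gamma> \<le> 1 / 2"
    using M\<gamma> mult_right_mono[OF M(2) less_imp_le[OF \<gamma>]] mult_right_mono[OF M(3) less_imp_le[OF \<gamma>]]
    by linarith+
  obtain k\<^sub>1 where k1: "0 < k\<^sub>1"
    "\<forall>\<^sub>F \<epsilon> in at_right 0. norm (u\<^sub>0 \<epsilon> - \<epsilon> * a\<^sub>0 \<epsilon> * cos (\<beta>\<^sub>0 \<epsilon>)) \<le> k\<^sub>1 * norm (\<epsilon>\<^sup>2)"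
    using compat unfolding compatible_initial_data_def by (auto elim: landau_o.bigE)
  obtain k\<^sub>2 where k2: "0 < k\<^sub>2"
    "\<forall>\<^sub>F \<epsilon> in at_right 0. norm (v\<^sub>0 \<epsilon> + \<epsilon> * \<omega> * a\<^sub>0 \<epsilon> * sin (\<beta>\<^sub>0 \<epsilon>)) \<le> k\<^sub>2 * norm (\<epsilon>\<^sup>2)"
    using compat unfolding compatible_initial_data_def by (auto elim: landau_o.bigE)
  \<comment> \<open>The constant of \<open>initial_envelope_close\<close> for the amplitude bound
    \<open>3 / 2 * A\<close>.\<close>
  define C\<^sub>0 where "C\<^sub>0 = k\<^sub>1 + 2 / \<omega> * (k\<^sub>2 + \<bar>\<sigma>\<bar> * (3 / 2 * A))"
  obtain K where K: "\<forall>\<epsilon> z Z. small \<epsilon> \<longrightarrow>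
      (\<forall>t\<in>{0..\<gamma> / \<epsilon>}. (z has_vector_derivative of_real \<epsilon> * fast_field \<epsilon> t (z t)) (at t within {0..\<gamma> / \<epsilon>})
        \<and> norm (z t) \<le> R) \<longrightarrow>
      (\<forall>t\<in>{0..\<gamma> / \<epsilon>}. (Z has_vector_derivative of_real \<epsilon> * slow_field (Z t)) (at t within {0..\<gamma> / \<epsilon>})
        \<and> norm (Z t) \<le> R) \<longrightarrow>
      norm (z 0 - Z 0) \<le> \<epsilon> * C\<^sub>0 \<longrightarrow> (\<forall>t\<in>{0..\<gamma> / \<epsilon>}. norm (z t - Z t) \<le> \<epsilon> * K)"
    by (rule exE[OF averaging_estimate[OF less_imp_le[OF \<gamma>] M2(1) M2\<gamma>(2), of R C\<^sub>0]])
      (rule M2(3), assumption, assumption, erule that)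
  \<comment> \<open>The averaging estimate does not fix the sign of \<open>K\<close>, and the
    remainder bound asks for a nonnegative constant.\<close>
  define K' where "K' = max K 0"
  define B where "B = (2 * \<omega> * M + 2 * \<omega> * M + C) + (K' + 2 * \<omega> * (2 * \<omega> * K' + M) + (2 * \<omega> * K' + M))"
  have "\<forall>\<^sub>F \<epsilon>::real in at_right 0. \<epsilon> * \<bar>C\<^sub>1\<bar> < A / 2"
    using A by (intro order_tendstoD(2)[where y = 0]) (auto intro!: tendsto_eq_intros)
  moreover have "\<forall>\<^sub>F \<epsilon>::real in at_right 0. \<epsilon> * C\<^sub>0 < A / 2"
    using A by (intro order_tendstoD(2)[where y = 0]) (auto intro!: tendsto_eq_intros)
  ultimately have "\<forall>\<^sub>F \<epsilon> in at_right 0. small \<epsilon> \<and> \<bar>a\<^sub>0 \<epsilon> - abar\<bar> \<le> A / 2 \<and> \<epsilon> * C\<^sub>0 \<le> A / 2 \<and>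
      \<bar>u\<^sub>0 \<epsilon> - \<epsilon> * a\<^sub>0 \<epsilon> * cos (\<beta>\<^sub>0 \<epsilon>)\<bar> \<le> k\<^sub>1 * \<epsilon>\<^sup>2 \<and>
      \<bar>v\<^sub>0 \<epsilon> + \<epsilon> * \<omega> * a\<^sub>0 \<epsilon> * sin (\<beta>\<^sub>0 \<epsilon>)\<bar> \<le> k\<^sub>2 * \<epsilon>\<^sup>2"
    using eventually_small a0_near k1(2) k2(2)
  proof eventually_elim
    case (elim \<epsilon>)
    have "\<epsilon> * C\<^sub>1 \<le> \<epsilon> * \<bar>C\<^sub>1\<bar>"
      using elim(3) by (intro mult_left_mono) (auto simp: small_def)
    with elim show ?case
      by simp
  qed
  then have "\<forall>\<^sub>F \<epsilon> in at_right 0.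
    (\<exists>u. oscillator_solution \<omega> lam c d F \<sigma> \<epsilon> {0..\<gamma> / \<epsilon>} (u\<^sub>0 \<epsilon>) (v\<^sub>0 \<epsilon>) u) \<and>
    (\<exists>a \<beta>. slow_solution \<omega> lam d F \<sigma> {0..\<gamma>} a \<beta> \<and> a 0 = a\<^sub>0 \<epsilon> \<and> \<beta> 0 = \<beta>\<^sub>0 \<epsilon>) \<and>
    (\<forall>u a \<beta>.
       oscillator_solution \<omega> lam c d F \<sigma> \<epsilon> {0..\<gamma> / \<epsilon>} (u\<^sub>0 \<epsilon>) (v\<^sub>0 \<epsilon>) u \<longrightarrow>
       slow_solution \<omega> lam d F \<sigma> {0..\<gamma>} a \<beta> \<and> a 0 = a\<^sub>0 \<epsilon> \<and> \<beta> 0 = \<beta>\<^sub>0 \<epsilon> \<longrightarrow>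
       (\<exists>r. (\<forall>t\<in>{0..\<gamma> / \<epsilon>}.
               u t = \<epsilon> * a (\<epsilon> * t) * cos ((\<omega> + \<epsilon> * \<sigma>) * t + \<beta> (\<epsilon> * t)) + \<epsilon>\<^sup>2 * r t) \<and>
            C2_bounded_on {0<..<\<gamma> / \<epsilon>} B r))"
  proof eventually_elim
    case (elim \<epsilon>)
    have \<epsilon>: "small \<epsilon>" and \<epsilon>0: "0 < \<epsilon>" "\<epsilon> \<le> 1"
      using elim by (auto simp: small_def)
    have a0: "A / 2 \<le> \<bar>a\<^sub>0 \<epsilon>\<bar>" "\<bar>a\<^sub>0 \<epsilon>\<bar> \<le> 3 / 2 * A"
      using elim unfolding A_def by linarith+
    define z\<^sub>0 where "z\<^sub>0 = Complex (u\<^sub>0 \<epsilon> / \<epsilon>) (- v\<^sub>0 \<epsilon> / (\<epsilon> * freq \<epsilon>))"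
    define Z\<^sub>0 where "Z\<^sub>0 = complex_of_real (a\<^sub>0 \<epsilon>) * cis (\<beta>\<^sub>0 \<epsilon>)"
    have Z0: "norm Z\<^sub>0 = \<bar>a\<^sub>0 \<epsilon>\<bar>"
      by (simp add: Z\<^sub>0_def norm_mult)
    have init: "norm (z\<^sub>0 - Z\<^sub>0) \<le> \<epsilon> * C\<^sub>0"
      unfolding z\<^sub>0_def Z\<^sub>0_def C\<^sub>0_def using k1(1) k2(1) a0(2) elim \<epsilon>
      by (intro initial_envelope_close) auto
    have z0: "norm z\<^sub>0 \<le> 2 * A"
      using init elim a0(2) Z0 norm_triangle_ineq2[of z\<^sub>0 Z\<^sub>0] by linarith
    show ?case
    proof (intro conjI allI impI)
      obtain z where "z 0 = z\<^sub>0" and z: "\<And>t. t \<in> {0..\<gamma> / \<epsilon>} \<Longrightarrow>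
          (z has_vector_derivative of_real \<epsilon> * fast_field \<epsilon> t (z t)) (at t within {0..\<gamma> / \<epsilon>})"
        by (rule fast_field_exists[where \<epsilon> = \<epsilon> and \<gamma> = \<gamma> and \<rho> = "A / 4" and R = R and M = M\<^sub>1 and z\<^sub>0 = z\<^sub>0])
          (use \<epsilon> \<gamma> A z0 M1 M1\<gamma> in \<open>auto simp: R_def\<close>)
      then show "\<exists>u. oscillator_solution \<omega> lam c d F \<sigma> \<epsilon> {0..\<gamma> / \<epsilon>} (u\<^sub>0 \<epsilon>) (v\<^sub>0 \<epsilon>) u"
        using envelope_imp_oscillator_solution[OF \<epsilon> z] unfolding z\<^sub>0_def by blast
    next
      obtain Z where Z: "Z 0 = Z\<^sub>0" "\<And>T. T \<in> {0..\<gamma>} \<Longrightarrow> norm (Z T - Z\<^sub>0) \<le> A / 4"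
        "\<And>T. T \<in> {0..\<gamma>} \<Longrightarrow> (Z has_vector_derivative slow_field (Z T)) (at T within {0..\<gamma>})"
        by (rule slow_field_exists[where \<gamma> = \<gamma> and \<rho> = "A / 4" and R = R and M = M\<^sub>2 and z\<^sub>0 = Z\<^sub>0])
          (use \<gamma> A Z0 a0 M2 M2\<gamma> in \<open>auto simp: R_def\<close>)
      \<comment> \<open>\<open>A / 4 < A / 2 \<le> \<bar>a\<^sub>0 \<epsilon>\<bar>\<close>: the
        trajectory stays away from the origin and lifts to polar coordinates.\<close>
      have "norm (Z T - Z 0) < norm (Z 0)" if "T \<in> {0..\<gamma>}" for T
        using Z(2)[OF that] A a0(1) Z0 unfolding Z(1) by linarith
      then show "\<exists>a \<beta>. slow_solution \<omega> lam d F \<sigma> {0..\<gamma>} a \<beta> \<and> a 0 = a\<^sub>0 \<epsilon> \<and> \<beta> 0 = \<beta>\<^sub>0 \<epsilon>"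
        using slow_field_imp_slow_solution[OF Z(3), of "a\<^sub>0 \<epsilon>" "\<beta>\<^sub>0 \<epsilon>"] Z(1) unfolding Z\<^sub>0_def by blast
    next
      fix u a \<beta>
      assume "oscillator_solution \<omega> lam c d F \<sigma> \<epsilon> {0..\<gamma> / \<epsilon>} (u\<^sub>0 \<epsilon>) (v\<^sub>0 \<epsilon>) u"
        and slow: "slow_solution \<omega> lam d F \<sigma> {0..\<gamma>} a \<beta> \<and> a 0 = a\<^sub>0 \<epsilon> \<and> \<beta> 0 = \<beta>\<^sub>0 \<epsilon>"
      then obtain u' u'' where u: "\<And>t. t \<in> {0..\<gamma> / \<epsilon>} \<Longrightarrow> (u has_real_derivative u' t) (at t within {0..\<gamma> / \<epsilon>})"
        "\<And>t. t \<in> {0..\<gamma> / \<epsilon>} \<Longrightarrow> (u' has_real_derivative u'' t) (at t within {0..\<gamma> / \<epsilon>})"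
        "\<And>t. t \<in> {0..\<gamma> / \<epsilon>} \<Longrightarrow> u'' t + \<omega>\<^sup>2 * u t + \<epsilon> * lam * u' t + c * (u t)\<^sup>2 + d / \<epsilon> * u t ^ 3
            = \<epsilon>\<^sup>2 * F * cos ((\<omega> + \<epsilon> * \<sigma>) * t)"
        and u0: "u 0 = u\<^sub>0 \<epsilon>" "u' 0 = v\<^sub>0 \<epsilon>"
        unfolding oscillator_solution_def by blast
      define z where "z t = Complex (u t / \<epsilon>) (- u' t / (\<epsilon> * freq \<epsilon>)) * cis (- (freq \<epsilon> * t))" for t
      note envelope = oscillator_solution_imp_envelope[OF \<epsilon> _ u z_def]
      have z: "(z has_vector_derivative of_real \<epsilon> * fast_field \<epsilon> t (z t)) (at t within {0..\<gamma> / \<epsilon>})"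
        if "t \<in> {0..\<gamma> / \<epsilon>}" for t
        by (rule envelope(4)[OF that])
      have z_init: "z 0 = z\<^sub>0"
        by (simp add: z_def z\<^sub>0_def u0)
      have near_z: "norm w \<le> R" if "norm (w - z\<^sub>0) \<le> A / 4" for w
        using that z0 norm_triangle_ineq2[of w z\<^sub>0] A unfolding R_def by linarith
      \<comment> \<open>Speed \<open>\<epsilon> * M\<^sub>1\<close> over time
        \<open>\<gamma> / \<epsilon>\<close> covers at most
        \<open>M\<^sub>1 * \<gamma> \<le> A / 8\<close>, so the given solution cannot leave the
        ball.\<close>
      have "norm (z t - z 0) \<le> A / 4" if "t \<in> {0..\<gamma> / \<epsilon>}" for t
      proof (rule solution_stays_in_ball[OF z _ _ _ _ that])
        show "norm (of_real \<epsilon> * fast_field \<epsilon> t (z t)) \<le> \<epsilon> * M\<^sub>1" if "norm (z t - z 0) \<le> A / 4" for t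
          using M1(2)[OF \<epsilon> near_z] that \<epsilon>0 unfolding z_init by (simp add: norm_mult)
      qed (use A M1(1) M1\<gamma>(1) \<epsilon>0 in auto)
      then have z_bd: "norm (z t) \<le> R" if "t \<in> {0..\<gamma> / \<epsilon>}" for t
        using near_z that unfolding z_init by blast
      define Z where "Z T = complex_of_real (a T) * cis (\<beta> T)" for T
      have Z: "(Z has_vector_derivative slow_field (Z T)) (at T within {0..\<gamma>})" if "T \<in> {0..\<gamma>}" for T
        unfolding Z_def[abs_def] using slow that by (intro slow_solution_imp_slow_field) auto
      have Z_init: "Z 0 = Z\<^sub>0"
        using slow by (simp add: Z_def Z\<^sub>0_def)
      have near_Z: "norm w \<le> R" if "norm (w - Z\<^sub>0) \<le> A / 4" for w
        using that Z0 a0(2) norm_triangle_ineq2[of w Z\<^sub>0] A unfolding R_def by linarith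
      have "norm (Z T - Z 0) \<le> A / 4" if "T \<in> {0..\<gamma>}" for T
      proof (rule solution_stays_in_ball[OF Z _ _ _ _ that])
        show "norm (slow_field (Z T)) \<le> M\<^sub>2" if "norm (Z T - Z 0) \<le> A / 4" for T
          using M2(2)[OF near_Z] that unfolding Z_init by simp
      qed (use A M2(1) M2\<gamma>(1) in auto)
      then have Z_bd: "norm (Z T) \<le> R" if "T \<in> {0..\<gamma>}" for T
        using near_Z that unfolding Z_init by blast
      \<comment> \<open>The slow solution in fast time; the chain rule supplies the factor
        \<epsilon> that makes it comparable with \<open>z\<close>.\<close>
      define W where "W t = Z (\<epsilon> * t)" for t
      have times: "\<epsilon> * t \<in> {0..\<gamma>}" if "t \<in> {0..\<gamma> / \<epsilon>}" for t
        using that \<epsilon>0 by (auto simp: field_simps)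
      have W: "(W has_vector_derivative of_real \<epsilon> * slow_field (W t)) (at t within {0..\<gamma> / \<epsilon>})"
        if t: "t \<in> {0..\<gamma> / \<epsilon>}" for t
      proof -
        have "((\<lambda>t. \<epsilon> * t) has_vector_derivative \<epsilon>) (at t within {0..\<gamma> / \<epsilon>})"
          by (auto intro!: derivative_eq_intros simp: has_vector_derivative_def)
        moreover have "(Z has_vector_derivative slow_field (Z (\<epsilon> * t))) (at (\<epsilon> * t) within (\<lambda>t. \<epsilon> * t) ` {0..\<gamma> / \<epsilon>})"
          using times by (intro has_vector_derivative_within_subset[OF Z[OF times[OF t]]]) blast
        ultimately show ?thesis
          using vector_diff_chain_within[of "\<lambda>t. \<epsilon> * t" \<epsilon> t "{0..\<gamma> / \<epsilon>}" Z "slow_field (Z (\<epsilon> * t))"]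
          by (simp add: o_def W_def[abs_def] scaleR_conv_of_real)
      qed
      have W_bd: "norm (W t) \<le> R" if "t \<in> {0..\<gamma> / \<epsilon>}" for t
        unfolding W_def by (rule Z_bd[OF times[OF that]])
      have close_K: "norm (z t - W t) \<le> \<epsilon> * K" if "t \<in> {0..\<gamma> / \<epsilon>}" for t
      proof -
        have "norm (z 0 - W 0) \<le> \<epsilon> * C\<^sub>0"
          using init by (simp add: z_init W_def Z_init)
        then show ?thesis
          using K \<epsilon> z z_bd W W_bd that by blast
      qed
      have close: "norm (z t - W t) \<le> \<epsilon> * K'" if "t \<in> {0..\<gamma> / \<epsilon>}" for t
        by (rule order_trans[OF close_K[OF that]]) (use \<epsilon>0 in \<open>simp add: K'_def\<close>)
      define r where "r t = Re ((z t - W t) / of_real \<epsilon> * cis (freq \<epsilon> * t))" for t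
      have "u t = \<epsilon> * a (\<epsilon> * t) * cos ((\<omega> + \<epsilon> * \<sigma>) * t + \<beta> (\<epsilon> * t)) + \<epsilon>\<^sup>2 * r t"
        if "t \<in> {0..\<gamma> / \<epsilon>}" for t
      proof -
        have "W t * cis (freq \<epsilon> * t) = of_real (a (\<epsilon> * t)) * cis (freq \<epsilon> * t + \<beta> (\<epsilon> * t))"
          by (simp add: W_def Z_def mult.assoc cis_mult add.commute)
        then have "Re (W t * cis (freq \<epsilon> * t)) = a (\<epsilon> * t) * cos (freq \<epsilon> * t + \<beta> (\<epsilon> * t))"
          by simp
        moreover have "(z t - W t) / of_real \<epsilon> * cis (freq \<epsilon> * t)
            = of_real (1 / \<epsilon>) * (z t * cis (freq \<epsilon> * t) - W t * cis (freq \<epsilon> * t))"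
          by (simp add: field_simps)
        then have "r t = 1 / \<epsilon> * (Re (z t * cis (freq \<epsilon> * t)) - Re (W t * cis (freq \<epsilon> * t)))"
          unfolding r_def by (simp only: Re_complex_of_real Im_complex_of_real times_complex.sel(1)[of "of_real (1 / \<epsilon>)"]
              minus_complex.sel mult_zero_left diff_zero)
        ultimately have "\<epsilon> * r t = Re (z t * cis (freq \<epsilon> * t)) - a (\<epsilon> * t) * cos (freq \<epsilon> * t + \<beta> (\<epsilon> * t))"
          using \<epsilon>0 by (simp del: times_complex.sel)
        then have "Re (z t * cis (freq \<epsilon> * t)) = a (\<epsilon> * t) * cos (freq \<epsilon> * t + \<beta> (\<epsilon> * t)) + \<epsilon> * r t"
          by linarith
        then show ?thesis
          using envelope(1)[OF that] by (simp only: freq_def power2_eq_square distrib_left mult.assoc)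
      qed
      moreover have "C2_bounded_on {0<..<\<gamma> / \<epsilon>} B r"
        unfolding B_def r_def[abs_def]
      proof (rule remainder_C2_bounded[OF \<epsilon>])
        fix t assume "t \<in> {0<..<\<gamma> / \<epsilon>}"
        then have t: "t \<in> {0..\<gamma> / \<epsilon>}" by auto
        show "(z has_vector_derivative of_real \<epsilon> * fast_field \<epsilon> t (z t)) (at t within {0<..<\<gamma> / \<epsilon>})"
          by (rule has_vector_derivative_within_subset[OF z[OF t]]) auto
        show "(W has_vector_derivative of_real \<epsilon> * slow_field (W t)) (at t within {0<..<\<gamma> / \<epsilon>})"
          by (rule has_vector_derivative_within_subset[OF W[OF t]]) auto
        show "norm (z t - W t) \<le> \<epsilon> * K'"
          by (rule close[OF t])
        show "norm (fast_field \<epsilon> t (z t)) \<le> M"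
          by (rule order_trans[OF M1(2)[OF \<epsilon> z_bd[OF t]] M(2)])
        show "norm (slow_field (W t)) \<le> M"
          by (rule order_trans[OF M2(2)[OF W_bd[OF t]] M(3)])
        \<comment> \<open>\<open>C\<close> was chosen for directions of norm at most
          \<open>M\<^sub>2\<close>; \<open>\<epsilon> \<le> 1\<close> brings the direction
          \<open>\<epsilon> * slow_field (W t)\<close> into that range.\<close>
        have "\<epsilon> * norm (slow_field (W t)) \<le> 1 * M\<^sub>2"
          using \<epsilon>0 M2(2)[OF W_bd[OF t]] by (intro mult_mono) auto
        then show "norm (slow_field_derivative (W t) (of_real \<epsilon> * slow_field (W t))) \<le> C"
          using \<epsilon>0 by (intro C(2) W_bd[OF t]) (simp add: norm_mult)
      qed (simp add: K'_def)
      ultimately show "\<exists>r. (\<forall>t\<in>{0..\<gamma> / \<epsilon>}.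
               u t = \<epsilon> * a (\<epsilon> * t) * cos ((\<omega> + \<epsilon> * \<sigma>) * t + \<beta> (\<epsilon> * t)) + \<epsilon>\<^sup>2 * r t) \<and>
            C2_bounded_on {0<..<\<gamma> / \<epsilon>} B r"
        by blast
    qed
  qed
  with \<gamma> show ?thesis
    by blast
qed

end

theorem proposition2p3:
  fixes \<omega> lam c d F \<sigma> abar \<beta>bar C\<^sub>1 C\<^sub>2 :: real
    and a\<^sub>0 \<beta>\<^sub>0 u\<^sub>0 v\<^sub>0 :: "real \<Rightarrow> real"
  assumes "\<omega> > 0" and "lam > 0"
    and "slow_stationary \<omega> lam d F \<sigma> abar \<beta>bar" and "abar \<noteq> 0"
    and "compatible_initial_data \<omega> a\<^sub>0 \<beta>\<^sub>0 u\<^sub>0 v\<^sub>0"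
    and "\<forall>\<^sub>F \<epsilon> in at_right 0. \<bar>a\<^sub>0 \<epsilon> - abar\<bar> \<le> \<epsilon> * C\<^sub>1"
    and "\<forall>\<^sub>F \<epsilon> in at_right 0. \<bar>\<beta>\<^sub>0 \<epsilon> - \<beta>bar\<bar> \<le> \<epsilon> * C\<^sub>2"
    and "0 \<le> 9 * d\<^sup>2 * abar ^ 4 / (16 * \<omega>\<^sup>2) - lam\<^sup>2"
    and "\<sigma> \<le> 3 * d * abar\<^sup>2 / (4 * \<omega>)
              - 1 / 2 * sqrt (9 * d\<^sup>2 * abar ^ 4 / (16 * \<omega>\<^sup>2) - lam\<^sup>2)"
  shows "\<exists>\<gamma>>0. \<exists>K. \<forall>\<^sub>F \<epsilon> in at_right 0.
    (\<exists>u. oscillator_solution \<omega> lam c d F \<sigma> \<epsilon> {0..\<gamma> / \<epsilon>} (u\<^sub>0 \<epsilon>) (v\<^sub>0 \<epsilon>) u) \<and>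
    (\<exists>a \<beta>. slow_solution \<omega> lam d F \<sigma> {0..\<gamma>} a \<beta> \<and> a 0 = a\<^sub>0 \<epsilon> \<and> \<beta> 0 = \<beta>\<^sub>0 \<epsilon>) \<and>
    (\<forall>u a \<beta>.
       oscillator_solution \<omega> lam c d F \<sigma> \<epsilon> {0..\<gamma> / \<epsilon>} (u\<^sub>0 \<epsilon>) (v\<^sub>0 \<epsilon>) u \<longrightarrow>
       slow_solution \<omega> lam d F \<sigma> {0..\<gamma>} a \<beta> \<and> a 0 = a\<^sub>0 \<epsilon> \<and> \<beta> 0 = \<beta>\<^sub>0 \<epsilon> \<longrightarrow>
       (\<exists>r. (\<forall>t\<in>{0..\<gamma> / \<epsilon>}.
               u t = \<epsilon> * a (\<epsilon> * t) * cos ((\<omega> + \<epsilon> * \<sigma>) * t + \<beta> (\<epsilon> * t)) + \<epsilon>\<^sup>2 * r t) \<and>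
            C2_bounded_on {0<..<\<gamma> / \<epsilon>} K r))"
proof -
  interpret weakly_nonlinear_oscillator \<omega> lam c d F \<sigma>
    by unfold_locales (fact assms(1))
  show ?thesis
    by (rule slow_modulation[OF assms(4,5,6)])
qed

end
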